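(* Let $(X,\Sigma,\mu)$ be a locally measure space and let $\{\mathcal{H}_p;\ \mathcal{E}_p=\{\mathcal{H}_{\alpha,p}\}_{\alpha\in\Lambda};\ \mathcal{D}_p\}_{p\in X}$ be a family of quantized domains. Then the direct integral $\mathcal{D}=\int^{\oplus_{\mathrm{loc}}}_{X_{\mathrm{loc}}}\mathcal{D}_p\,\mathrm{d}\mu(p)$ of the locally Hilbert spaces $\{\mathcal{D}_p\}_{p\in X}$ is a locally Hilbert space.
   Context: Throughout, $(\Lambda,\le)$ is a directed poset. Locally Hilbert space and quantized domain: a strictly inductive system of Hilbert spaces is a family $\{\mathcal{H}_\alpha\}_{\alpha\in\Lambda}$ of Hilbert spaces such that for $\alpha\le\beta$ one has $\mathcal{H}_\alpha\subseteq\mathcal{H}_\beta$ and the inclusion is isometric, i.e. $\langle u,v\rangle_{\mathcal{H}_\alpha}=\langle u,v\rangle_{\mathcal{H}_\beta}$ for $u,v\in\mathcal{H}_\alpha$. A locally Hilbert space is the inductive limit $\mathcal{D}=\varinjlim_\alpha\mathcal{H}_\alpha=\bigcup_{\alpha}\mathcal{H}_\alpha$ of a strictly inductive system of Hilbert spaces. A quantized domain $\{\mathcal{H};\mathcal{F}=\{\mathcal{H}_\alpha\}_{\alpha\in\Lambda};\mathcal{D}\}$ consists of a strictly inductive system $\mathcal{F}$, its union $\mathcal{D}$, and the Hilbert space completion $\mathcal{H}=\overline{\mathcal{D}}$. Locally measure space: let $\{(X_\alpha,\Sigma_\alpha,\mu_\alpha)\}_{\alpha\in\Lambda}$ be measure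 spaces such that for $\alpha\le\beta$: $X_\alpha\subseteq X_\beta$, $\Sigma_\alpha=\{E\cap X_\alpha:E\in\Sigma_\beta\}$ and $\Sigma_\alpha\subseteq\Sigma_\beta$, and $\mu_\alpha(E)=\mu_\beta(E)$ for all $E\in\Sigma_\alpha$. Put $X=\bigcup_\alpha X_\alpha$, $\Sigma=\{E\subseteq X: E\cap X_\alpha\in\Sigma_\alpha\ \forall\alpha\}$, and $\mu(E)=\lim_\alpha\mu_\alpha(E\cap X_\alpha)$ if this net converges, $\mu(E)=\infty$ otherwise. Then $(X,\Sigma,\mu)$ is a measure space, called a locally measure space. Standing assumption: each $X_\alpha$ is a $\sigma$-compact locally compact space, $\Sigma_\alpha$ is a Borel $\sigma$-algebra on $X_\alpha$, and $\mu_\alpha$ is the completion of a positive Borel measure on $X_\alpha$. Direct integral of locally Hilbert spaces: to each $p\in X$ assign a quantized domain $\{\mathcal{H}_p;\mathcal{E}_p=\{\mathcal{H}_{\alpha,p}\}_{\alpha\in\Lambda};\mathcal{D}_p\}$. The direct integral $\int^{\oplus_{\mathrm{loc}}}_{X_{\mathrm{loc}}}\mathcal{D}_p\,\mathrm{d}\mu(p)$ is a space $\mathcal{D}$ of maps $u:X\to\bigcup_{p\in X}\mathcal{D}_p$ with $u(p)\in\mathcal{D}_p$ for all $p$ (as usual, maps agreeing $\mu$-a.e. are identified), such that: (1) for each $u\in\mathcal{D}$ there is $\alpha_u\in\Lambda$ with $u(p)\in\mathcal{H}_{\alpha_u,p}$ for a.e. $p\in X_{\alpha_u}$ and $\mathrm{supp}(u):=\{p\in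 X:u(p)\ne0\}\subseteq X_{\alpha_u}$; (2) for all $u,v\in\mathcal{D}$ the function $\zeta_{u,v}(p):=\langle u(p),v(p)\rangle_{\mathcal{D}_p}$ belongs to $L^1(X,\mu)$; (3) if $v:X\to\bigcup_{p\in X}\mathcal{D}_p$ is such that there exists $\alpha\in\Lambda$ with $v(p)\in\mathcal{H}_{\alpha,p}$ for all $p\in X_\alpha$ and $v(p)=0_{\mathcal{D}_p}$ for all $p\in X\setminus X_\alpha$, and if $\zeta_{u,v}\in L^1(X,\mu)$ for every $u\in\mathcal{D}$, then $v\in\mathcal{D}$. *)

theory Defs
  imports "HOL-Analysis.Analysis" "HOL-Algebra.Algebraic_Closure_Type"
begin

section \<open>Directed index sets\<close>

class directed_order = order +
  assumes directed: "\<exists>c. a \<le> c \<and> b \<le> c"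

lemma at_top_directed_neq_bot: "(at_top :: 'i::directed_order filter) \<noteq> bot"
  unfolding at_top_def
proof (rule INF_filter_not_bot)
  fix B :: "'i set" assume "finite B"
  then have "\<exists>c. \<forall>b\<in>B. b \<le> c"
  proof (induction B rule: finite_induct)
    case (insert x F)
    then show ?case by (metis directed insertE order_trans)
  qed simp
  then obtain c where "\<forall>b\<in>B. b \<le> c" ..
  then have "c \<in> (\<Inter>k\<in>B. {k..})" by auto
  then show "(INF k\<in>B. principal {k..}) \<noteq> bot"
    using \<open>finite B\<close>
    by (metis INF_principal_finite empty_iff principal_eq_bot_iff)
qed

lemma eventually_ge_at_top_directed: "eventually (\<lambda>x. (c :: 'i::directed_order) \<le> x) at_top"
  unfolding at_top_def by (rule eventually_INF1[of c]) (auto simp: eventually_principal)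

lemma tendsto_SUP_directed:
  fixes f :: "'i::directed_order \<Rightarrow> ennreal"
  assumes "mono f"
  shows "(f \<longlongrightarrow> (SUP a. f a)) at_top"
proof (rule order_tendstoI)
  fix y assume "y < (SUP a. f a)"
  then obtain a where a: "y < f a" by (auto simp: less_SUP_iff)
  show "eventually (\<lambda>x. y < f x) at_top"
    using eventually_ge_at_top_directed[of a]
    by eventually_elim (meson a assms less_le_trans monoD)
next
  fix y assume y: "(SUP a. f a) < y"
  show "eventually (\<lambda>x. f x < y) at_top"
    by (intro always_eventually allI le_less_trans[OF _ y] SUP_upper) auto
qed


section \<open>Complex Hilbert spaces on carrier sets\<close>

text \<open>
  A structure extends the \<open>HOL-Algebra\<close> record for modules by an inner product. Its inherited
  ring fields \<^const>\<open>monoid.mult\<close> and \<^const>\<open>monoid.one\<close> have no meaning here, as usual for modules.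
\<close>

record 'a ip_space = "(complex, 'a) module" +
  ip :: "'a \<Rightarrow> 'a \<Rightarrow> complex"

abbreviation complex_field :: "complex ring"
  where "complex_field \<equiv> ring_of_type_algebra"

locale complex_ip_space = Module.module complex_field V for V :: "('a, 'm) ip_space_scheme" (structure) +
  assumes ip_add_left:
    "\<lbrakk>x \<in> carrier V; y \<in> carrier V; z \<in> carrier V\<rbrakk> \<Longrightarrow> ip V (x \<oplus> y) z = ip V x z + ip V y z"
  and ip_smult_left: "\<lbrakk>x \<in> carrier V; y \<in> carrier V\<rbrakk> \<Longrightarrow> ip V (c \<odot> x) y = c * ip V x y"
  and ip_commute: "\<lbrakk>x \<in> carrier V; y \<in> carrier V\<rbrakk> \<Longrightarrow> ip V y x = cnj (ip V x y)"
  and ip_nonneg: "x \<in> carrier V \<Longrightarrow> 0 \<le> Re (ip V x x)"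
  and ip_definite: "x \<in> carrier V \<Longrightarrow> ip V x x = 0 \<Longrightarrow> x = \<zero>"

definition ip_norm :: "('a, 'm) ip_space_scheme \<Rightarrow> 'a \<Rightarrow> real"
  where "ip_norm V x = sqrt (Re (ip V x x))"

text \<open>
  The library locale \<^locale>\<open>Metric_space\<close> requires nonnegativity and symmetry also outside the
  carrier; hence the value \<open>0\<close> there.
\<close>

definition ip_dist :: "('a, 'm) ip_space_scheme \<Rightarrow> 'a \<Rightarrow> 'a \<Rightarrow> real"
  where "ip_dist V x y =
    (if x \<in> carrier V \<and> y \<in> carrier V then ip_norm V (x \<ominus>\<^bsub>V\<^esub> y) else 0)"

lemma complex_field_simps:
  "carrier complex_field = UNIV" "x \<oplus>\<^bsub>complex_field\<^esub> y = x + y" "x \<otimes>\<^bsub>complex_field\<^esub> y = x * y"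
  "\<zero>\<^bsub>complex_field\<^esub> = 0" "\<one>\<^bsub>complex_field\<^esub> = 1"
  by (simp_all add: ring_of_type_algebra_def)

context complex_ip_space
begin

lemma smult_closed': "x \<in> carrier V \<Longrightarrow> c \<odot> x \<in> carrier V"
  using smult_closed[of c x] by (simp add: complex_field_simps)

lemma smult_minus_one: "x \<in> carrier V \<Longrightarrow> (-1) \<odot> x = \<ominus> x"
proof -
  assume x: "x \<in> carrier V"
  have "(-1) \<odot> x \<oplus> 1 \<odot> x = (-1 + 1) \<odot> x"
    using smult_l_distr[of "-1" 1 x] x by (simp add: complex_field_simps)
  also have "\<dots> = \<zero>" using smult_l_null[OF x] by (simp add: complex_field_simps)
  finally have "(-1) \<odot> x \<oplus> x = \<zero>" using smult_one[OF x] by (simp add: complex_field_simps)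
  then show ?thesis using x smult_closed' by (metis M.minus_equality)
qed

lemma ip_add_right:
  assumes "x \<in> carrier V" "y \<in> carrier V" "z \<in> carrier V"
  shows "ip V x (y \<oplus> z) = ip V x y + ip V x z"
  using assms ip_add_left[of y z x] ip_commute[of x "y \<oplus> z"] ip_commute[of x y] ip_commute[of x z]
  by (metis M.a_closed complex_cnj_add complex_cnj_cnj)

lemma ip_smult_right:
  assumes "x \<in> carrier V" "y \<in> carrier V"
  shows "ip V x (c \<odot> y) = cnj c * ip V x y"
  using assms ip_smult_left[of y x c] ip_commute[of x "c \<odot> y"] ip_commute[of x y] smult_closed'
  by (metis complex_cnj_cnj complex_cnj_mult)

lemma Im_ip: "x \<in> carrier V \<Longrightarrow> Im (ip V x x) = 0"
  using ip_commute[of x x] by (metis Reals_cnj_iff complex_is_Real_iff)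

lemma ip_self: "x \<in> carrier V \<Longrightarrow> ip V x x = of_real ((ip_norm V x)\<^sup>2)"
  using Im_ip[of x] ip_nonneg[of x] by (simp add: ip_norm_def complex_eq_iff)

lemma ip_norm_nonneg: "x \<in> carrier V \<Longrightarrow> 0 \<le> ip_norm V x"
  using ip_nonneg[of x] by (simp add: ip_norm_def)

lemma ip_norm_zero_iff: "x \<in> carrier V \<Longrightarrow> ip_norm V x = 0 \<longleftrightarrow> x = \<zero>"
proof
  assume x: "x \<in> carrier V" "ip_norm V x = 0"
  then show "x = \<zero>" using ip_self[of x] ip_definite[of x] by simp
next
  assume "x = \<zero>"
  moreover have "ip V \<zero> \<zero> = 0" using ip_add_left[of \<zero> \<zero> \<zero>] by simp
  ultimately show "ip_norm V x = 0" by (simp add: ip_norm_def)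
qed

lemma ip_norm_smult: "x \<in> carrier V \<Longrightarrow> ip_norm V (c \<odot> x) = cmod c * ip_norm V x"
proof -
  assume x: "x \<in> carrier V"
  have "ip V (c \<odot> x) (c \<odot> x) = (c * cnj c) * ip V x x"
    using x by (simp add: ip_smult_left ip_smult_right smult_closed')
  also have "\<dots> = of_real ((cmod c)\<^sup>2 * (ip_norm V x)\<^sup>2)"
    using x by (simp only: ip_self of_real_mult complex_norm_square)
  finally have "ip V (c \<odot> x) (c \<odot> x) = of_real ((cmod c)\<^sup>2 * (ip_norm V x)\<^sup>2)" .
  then have "(ip_norm V (c \<odot> x))\<^sup>2 = (cmod c * ip_norm V x)\<^sup>2"
    using ip_self[OF smult_closed'[OF x], of c]
    by (metis of_real_eq_iff power_mult_distrib)
  then show ?thesis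
    using ip_norm_nonneg x smult_closed' by (simp add: power2_eq_iff_nonneg)
qed

lemma ip_norm_add_sq:
  assumes "x \<in> carrier V" "y \<in> carrier V"
  shows "(ip_norm V (x \<oplus> y))\<^sup>2 = (ip_norm V x)\<^sup>2 + 2 * Re (ip V x y) + (ip_norm V y)\<^sup>2"
proof -
  have "Re (ip V (x \<oplus> y) (x \<oplus> y)) = Re (ip V x x) + Re (ip V x y) + Re (ip V y x) + Re (ip V y y)"
    using assms by (simp add: ip_add_left ip_add_right)
  moreover have "Re (ip V y x) = Re (ip V x y)" using assms by (subst ip_commute) auto
  ultimately show ?thesis using assms by (simp add: ip_self)
qed

lemma Re_ip_le:
  assumes x: "x \<in> carrier V" and y: "y \<in> carrier V"
  shows "Re (ip V x y) \<le> ip_norm V x * ip_norm V y"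
proof -
  let ?a = "ip_norm V x" and ?b = "ip_norm V y" and ?r = "Re (ip V x y)"
  have q: "0 \<le> t\<^sup>2 * ?a\<^sup>2 + 2 * t * s * ?r + s\<^sup>2 * ?b\<^sup>2" for t s
  proof -
    have "0 \<le> (ip_norm V (of_real t \<odot> x \<oplus> of_real s \<odot> y))\<^sup>2" by simp
    also have "\<dots> = t\<^sup>2 * ?a\<^sup>2 + 2 * t * s * ?r + s\<^sup>2 * ?b\<^sup>2"
      using x y by (simp add: ip_norm_add_sq smult_closed' ip_norm_smult ip_smult_left ip_smult_right
          power_mult_distrib)
    finally show ?thesis .
  qed
  have ab: "0 \<le> ?a" "0 \<le> ?b" using ip_norm_nonneg x y by auto
  show ?thesis
  proof (cases "?a = 0 \<or> ?b = 0")
    case True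
    then have "ip V x y = 0"
    proof
      assume "?a = 0"
      then have "x = \<zero>" using x by (simp add: ip_norm_zero_iff)
      then show ?thesis using ip_add_left[of \<zero> \<zero> y] y by simp
    next
      assume "?b = 0"
      then have "y = \<zero>" using y by (simp add: ip_norm_zero_iff)
      then show ?thesis using ip_add_right[of x \<zero> \<zero>] x by simp
    qed
    then show ?thesis using True by auto
  next
    case False
    then have pos: "0 < ?a * ?b" using ab by (metis mult_pos_pos order_le_less)
    have "0 \<le> 2 * (?a * ?b) * (?a * ?b - ?r)"
      using q[of ?b "- ?a"] by (simp add: algebra_simps power2_eq_square)
    then show ?thesis using pos by (simp add: zero_le_mult_iff)
  qed
qed

lemma ip_norm_triangle:
  assumes x: "x \<in> carrier V" and y: "y \<in> carrier V"
  shows "ip_norm V (x \<oplus> y) \<le> ip_norm V x + ip_norm V y"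
proof (rule power2_le_imp_le)
  show "(ip_norm V (x \<oplus> y))\<^sup>2 \<le> (ip_norm V x + ip_norm V y)\<^sup>2"
    using Re_ip_le[OF assms] by (simp add: ip_norm_add_sq[OF assms] power2_sum)
  show "0 \<le> ip_norm V x + ip_norm V y" using assms ip_norm_nonneg by simp
qed

lemma Metric_space_ip_dist: "Metric_space (carrier V) (ip_dist V)"
proof
  show "0 \<le> ip_dist V x y" for x y by (simp add: ip_dist_def ip_norm_nonneg)
  show "ip_dist V x y = ip_dist V y x" for x y
  proof (cases "x \<in> carrier V \<and> y \<in> carrier V")
    case True
    then have "x \<ominus> y = (-1) \<odot> (y \<ominus> x)"
      by (simp add: smult_minus_one M.minus_eq M.minus_add M.a_comm)
    then show ?thesis using True by (simp add: ip_dist_def ip_norm_smult)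
  qed (auto simp: ip_dist_def)
  show "ip_dist V x y = 0 \<longleftrightarrow> x = y" if "x \<in> carrier V" "y \<in> carrier V" for x y
  proof -
    have "x \<ominus> y = \<zero> \<longleftrightarrow> x = y"
      using that by (metis M.minus_eq M.minus_equality M.minus_minus M.a_inv_closed M.r_neg)
    then show ?thesis using that by (simp add: ip_dist_def ip_norm_zero_iff)
  qed
  show "ip_dist V x z \<le> ip_dist V x y + ip_dist V y z"
    if "x \<in> carrier V" "y \<in> carrier V" "z \<in> carrier V" for x y z
  proof -
    have "x \<ominus> z = (x \<ominus> y) \<oplus> (y \<ominus> z)"
      using that by (simp add: M.minus_eq M.a_assoc M.r_neg1 M.r_neg2)
    then show ?thesis using that ip_norm_triangle[of "x \<ominus> y" "y \<ominus> z"] by (simp add: ip_dist_def)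
  qed
qed

end

locale hilbert_space = complex_ip_space +
  assumes complete: "Metric_space.mcomplete (carrier V) (ip_dist V)"

definition isometric_inclusion :: "'a ip_space \<Rightarrow> 'a ip_space \<Rightarrow> bool"
  where "isometric_inclusion V W \<longleftrightarrow>
    carrier V \<subseteq> carrier W \<and> \<zero>\<^bsub>V\<^esub> = \<zero>\<^bsub>W\<^esub> \<and>
    (\<forall>x\<in>carrier V. \<forall>y\<in>carrier V. x \<oplus>\<^bsub>V\<^esub> y = x \<oplus>\<^bsub>W\<^esub> y) \<and>
    (\<forall>c. \<forall>x\<in>carrier V. c \<odot>\<^bsub>V\<^esub> x = c \<odot>\<^bsub>W\<^esub> x) \<and>
    (\<forall>x\<in>carrier V. \<forall>y\<in>carrier V. ip V x y = ip W x y)"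


section \<open>Locally Hilbert spaces and quantized domains\<close>

definition strictly_inductive_system :: "('i::directed_order \<Rightarrow> 'a ip_space) \<Rightarrow> bool"
  where "strictly_inductive_system E \<longleftrightarrow>
    (\<forall>a. hilbert_space (E a)) \<and> (\<forall>a b. a \<le> b \<longrightarrow> isometric_inclusion (E a) (E b))"

definition inductive_limit :: "('i::directed_order \<Rightarrow> 'a ip_space) \<Rightarrow> 'a ip_space \<Rightarrow> bool"
  where "inductive_limit E D \<longleftrightarrow>
    carrier D = (\<Union>a. carrier (E a)) \<and> (\<forall>a. isometric_inclusion (E a) D)"

definition locally_hilbert_space :: "'i::directed_order itself \<Rightarrow> 'a ip_space \<Rightarrow> bool"
  where "locally_hilbert_space _ D \<longleftrightarrow>
    (\<exists>E :: 'i \<Rightarrow> 'a ip_space. strictly_inductive_system E \<and> inductive_limit E D)"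

definition quantized_domain ::
    "'a ip_space \<Rightarrow> ('i::directed_order \<Rightarrow> 'a ip_space) \<Rightarrow> 'a ip_space \<Rightarrow> bool"
  where "quantized_domain H E D \<longleftrightarrow>
    strictly_inductive_system E \<and> inductive_limit E D \<and>
    hilbert_space H \<and> isometric_inclusion D H \<and>
    Metric_space.mtopology (carrier H) (ip_dist H) closure_of (carrier D) = carrier H"


section \<open>Locally measure spaces\<close>

definition sigma_compact_space :: "'x topology \<Rightarrow> bool"
  where "sigma_compact_space T \<longleftrightarrow>
    (\<exists>K :: nat \<Rightarrow> 'x set. (\<forall>n. compactin T (K n)) \<and> topspace T = (\<Union>n. K n))"

text \<open>
  The \<open>\<sigma>\<close>-algebra of \<open>M a\<close> is the completed one: \<^const>\<open>completion\<close> adds to the Borel sets of \<open>T a\<close>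
  the subsets of Borel null sets.
\<close>

locale locally_measure_system =
  fixes T :: "'i::directed_order \<Rightarrow> 'x topology" and M :: "'i \<Rightarrow> 'x measure"
  assumes space_mono: "a \<le> b \<Longrightarrow> space (M a) \<subseteq> space (M b)"
    and sets_restrict: "a \<le> b \<Longrightarrow> sets (M a) = {E \<inter> space (M a) | E. E \<in> sets (M b)}"
    and sets_mono: "a \<le> b \<Longrightarrow> sets (M a) \<subseteq> sets (M b)"
    and emeasure_eq: "a \<le> b \<Longrightarrow> E \<in> sets (M a) \<Longrightarrow> emeasure (M a) E = emeasure (M b) E"
    and topspace_eq: "topspace (T a) = space (M a)"
    and locally_compact: "locally_compact_space (T a)"
    and sigma_compact: "sigma_compact_space (T a)"
    and completed_borel: "\<exists>N. space N = topspace (T a) \<and>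
          sets N = sigma_sets (topspace (T a)) {U. openin (T a) U} \<and> M a = completion N"

definition loc_space :: "('i \<Rightarrow> 'x measure) \<Rightarrow> 'x set"
  where "loc_space M = (\<Union>a. space (M a))"

definition loc_sets :: "('i \<Rightarrow> 'x measure) \<Rightarrow> 'x set set"
  where "loc_sets M = {E. E \<subseteq> loc_space M \<and> (\<forall>a. E \<inter> space (M a) \<in> sets (M a))}"

text \<open>The filter \<^const>\<open>at_top\<close> on a directed order is the one of convergence of nets.\<close>

definition loc_emeasure :: "('i::directed_order \<Rightarrow> 'x measure) \<Rightarrow> 'x set \<Rightarrow> ennreal"
  where "loc_emeasure M E =
    (if \<exists>l. ((\<lambda>a. emeasure (M a) (E \<inter> space (M a))) \<longlongrightarrow> l) at_top
     then Lim at_top (\<lambda>a. emeasure (M a) (E \<inter> space (M a))) else \<infinity>)"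

definition loc_measure :: "('i::directed_order \<Rightarrow> 'x measure) \<Rightarrow> 'x measure"
  where "loc_measure M = measure_of (loc_space M) (loc_sets M) (loc_emeasure M)"

context locally_measure_system
begin

lemma loc_sets_closed: "loc_sets M \<subseteq> Pow (loc_space M)"
  by (auto simp: loc_sets_def)

lemma sigma_algebra_loc_sets: "sigma_algebra (loc_space M) (loc_sets M)"
proof -
  have 1: "loc_space M - E \<in> loc_sets M" if E: "E \<in> loc_sets M" for E
  proof -
    have "(loc_space M - E) \<inter> space (M a) = space (M a) - E \<inter> space (M a)" for a
      by (auto simp: loc_space_def)
    with E show ?thesis by (auto simp: loc_sets_def)
  qed
  have 2: "(\<Union>n. A n) \<in> loc_sets M" if A: "range A \<subseteq> loc_sets M" for A :: "nat \<Rightarrow> 'x set"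
  proof -
    have "(\<Union>n. A n) \<inter> space (M a) = (\<Union>n. A n \<inter> space (M a))" for a by auto
    moreover have "(\<Union>n. A n \<inter> space (M a)) \<in> sets (M a)" for a
      using A by (intro sets.countable_UN) (auto simp: loc_sets_def)
    ultimately show ?thesis using A by (auto simp: loc_sets_def)
  qed
  have "{} \<in> loc_sets M" by (simp add: loc_sets_def)
  then show ?thesis
    unfolding sigma_algebra_iff2 using 1 2 loc_sets_closed by simp
qed

lemma mono_emeasure_Int:
  assumes "E \<in> loc_sets M" shows "mono (\<lambda>a. emeasure (M a) (E \<inter> space (M a)))"
proof (rule monoI)
  fix a b :: 'i assume ab: "a \<le> b"
  have *: "E \<inter> space (M c) \<in> sets (M c)" for c using assms by (auto simp: loc_sets_def)
  have "emeasure (M a) (E \<inter> space (M a)) = emeasure (M b) (E \<inter> space (M a))"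
    using emeasure_eq[OF ab *] .
  also have "\<dots> \<le> emeasure (M b) (E \<inter> space (M b))"
    using space_mono[OF ab] * by (intro emeasure_mono) auto
  finally show "emeasure (M a) (E \<inter> space (M a)) \<le> emeasure (M b) (E \<inter> space (M b))" .
qed

lemma loc_emeasure_eq_SUP:
  assumes "E \<in> loc_sets M"
  shows "loc_emeasure M E = (SUP a. emeasure (M a) (E \<inter> space (M a)))"
  using tendsto_SUP_directed[OF mono_emeasure_Int[OF assms]]
  unfolding loc_emeasure_def by (auto intro: tendsto_Lim[OF at_top_directed_neq_bot])

lemma space_loc_measure: "space (loc_measure M) = loc_space M"
  using loc_sets_closed
  by (simp add: loc_measure_def)

lemma sets_loc_measure: "sets (loc_measure M) = loc_sets M"
  using loc_sets_closed
  by (simp add: loc_measure_def sigma_algebra.sigma_sets_eq[OF sigma_algebra_loc_sets])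

lemma emeasure_loc_measure:
  assumes E: "E \<in> loc_sets M"
  shows "emeasure (loc_measure M) E = loc_emeasure M E"
proof (rule emeasure_measure_of[OF loc_measure_def])
  show "loc_sets M \<subseteq> Pow (loc_space M)"
    by (rule loc_sets_closed)
  show "E \<in> sets (loc_measure M)" using E by (simp add: sets_loc_measure)
  show "positive (sets (loc_measure M)) (loc_emeasure M)"
    by (simp add: positive_def loc_emeasure_eq_SUP loc_sets_def)
  show "countably_additive (sets (loc_measure M)) (loc_emeasure M)"
    unfolding countably_additive_def sets_loc_measure
  proof safe
    fix A :: "nat \<Rightarrow> 'x set"
    assume A: "range A \<subseteq> loc_sets M" "disjoint_family A" "(\<Union>n. A n) \<in> loc_sets M"
    then have An: "A n \<in> loc_sets M" for n by auto
    have "(\<Sum>n. loc_emeasure M (A n)) = (\<Sum>n. SUP a. emeasure (M a) (A n \<inter> space (M a)))"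
      by (simp add: loc_emeasure_eq_SUP An)
    also have "\<dots> = (SUP a. \<Sum>n. emeasure (M a) (A n \<inter> space (M a)))"
    proof (rule ennreal_suminf_SUP_eq_directed)
      fix N :: "nat set" and i j :: 'i
      obtain k where "i \<le> k" "j \<le> k" using directed by blast
      then show "\<exists>k\<in>UNIV. \<forall>n\<in>N. emeasure (M i) (A n \<inter> space (M i)) \<le> emeasure (M k) (A n \<inter> space (M k)) \<and>
          emeasure (M j) (A n \<inter> space (M j)) \<le> emeasure (M k) (A n \<inter> space (M k))"
        using monoD[OF mono_emeasure_Int[OF An]] by blast
    qed
    also have "(\<lambda>a. \<Sum>n. emeasure (M a) (A n \<inter> space (M a))) =
        (\<lambda>a. emeasure (M a) ((\<Union>n. A n) \<inter> space (M a)))"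
    proof
      fix a
      have "(\<Sum>n. emeasure (M a) (A n \<inter> space (M a))) = emeasure (M a) (\<Union>n. A n \<inter> space (M a))"
        using An A(2) by (intro suminf_emeasure)
          (auto simp: loc_sets_def intro: disjoint_family_on_bisimulation[OF A(2)])
      then show "(\<Sum>n. emeasure (M a) (A n \<inter> space (M a))) = emeasure (M a) ((\<Union>n. A n) \<inter> space (M a))"
        by simp
    qed
    finally show "(\<Sum>n. loc_emeasure M (A n)) = loc_emeasure M (\<Union>n. A n)"
      by (simp add: loc_emeasure_eq_SUP A(3))
  qed
qed

end


section \<open>Direct integrals of locally Hilbert spaces\<close>

definition sections :: "('i \<Rightarrow> 'x measure) \<Rightarrow> ('x \<Rightarrow> 'h ip_space) \<Rightarrow> ('x \<Rightarrow> 'h) set"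
  where "sections M D = (\<Pi>\<^sub>E p\<in>loc_space M. carrier (D p))"

text \<open>
  Linearity is not listed: modulo null sets, it follows from the three conditions.
\<close>

definition direct_integral :: "('i::directed_order \<Rightarrow> 'x measure) \<Rightarrow> ('x \<Rightarrow> 'i \<Rightarrow> 'h ip_space) \<Rightarrow>
    ('x \<Rightarrow> 'h ip_space) \<Rightarrow> ('x \<Rightarrow> 'h) set \<Rightarrow> bool"
  where "direct_integral M E D \<D> \<longleftrightarrow>
    \<D> \<subseteq> sections M D \<and>
    (\<forall>u\<in>\<D>. \<exists>a. (AE p in loc_measure M. p \<in> space (M a) \<longrightarrow> u p \<in> carrier (E p a)) \<and>
       {p \<in> loc_space M. u p \<noteq> \<zero>\<^bsub>D p\<^esub>} \<subseteq> space (M a)) \<and>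
    (\<forall>u\<in>\<D>. \<forall>v\<in>\<D>. integrable (loc_measure M) (\<lambda>p. ip (D p) (u p) (v p))) \<and>
    (\<forall>v\<in>sections M D.
       (\<exists>a. (\<forall>p\<in>space (M a). v p \<in> carrier (E p a)) \<and>
            (\<forall>p\<in>loc_space M - space (M a). v p = \<zero>\<^bsub>D p\<^esub>)) \<longrightarrow>
       (\<forall>u\<in>\<D>. integrable (loc_measure M) (\<lambda>p. ip (D p) (u p) (v p))) \<longrightarrow>
       v \<in> \<D>)"

definition ae_rel :: "('i::directed_order \<Rightarrow> 'x measure) \<Rightarrow> ('x \<Rightarrow> 'h ip_space) \<Rightarrow> (('x \<Rightarrow> 'h) \<times> ('x \<Rightarrow> 'h)) set"
  where "ae_rel M D = {(u, v). u \<in> sections M D \<and> v \<in> sections M D \<and> (AE p in loc_measure M. u p = v p)}"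

abbreviation ae_class :: "('i::directed_order \<Rightarrow> 'x measure) \<Rightarrow> ('x \<Rightarrow> 'h ip_space) \<Rightarrow> ('x \<Rightarrow> 'h) \<Rightarrow> ('x \<Rightarrow> 'h) set"
  where "ae_class M D u \<equiv> ae_rel M D `` {u}"

definition ae_rep :: "('x \<Rightarrow> 'h) set \<Rightarrow> 'x \<Rightarrow> 'h"
  where "ae_rep A = (SOME u. u \<in> A)"

text \<open>
  The space of classes of members of \<open>\<D>\<close>. A class consists of all sections that agree almost
  everywhere, including those not in \<open>\<D>\<close>; the operations do not depend on the representatives.
\<close>

definition direct_integral_space :: "('i::directed_order \<Rightarrow> 'x measure) \<Rightarrow> ('x \<Rightarrow> 'h ip_space) \<Rightarrow>
    ('x \<Rightarrow> 'h) set \<Rightarrow> ('x \<Rightarrow> 'h) set ip_space"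
  where "direct_integral_space M D \<D> =
    \<lparr>carrier = \<D> // ae_rel M D,
     monoid.mult = undefined, one = undefined,
     zero = ae_class M D (\<lambda>p\<in>loc_space M. \<zero>\<^bsub>D p\<^esub>),
     add = (\<lambda>A B. ae_class M D (\<lambda>p\<in>loc_space M. ae_rep A p \<oplus>\<^bsub>D p\<^esub> ae_rep B p)),
     smult = (\<lambda>c A. ae_class M D (\<lambda>p\<in>loc_space M. c \<odot>\<^bsub>D p\<^esub> ae_rep A p)),
     ip = (\<lambda>A B. \<integral>p. ip (D p) (ae_rep A p) (ae_rep B p) \<partial>loc_measure M)\<rparr>"

end

theory Submission
  imports Defs
begin

text \<open>
  For an index \<open>a\<close> let \<open>level a\<close> consist of the \<open>v \<in> \<D>\<close> with \<open>v p \<in> \<H>\<^sub>a\<^sub>,\<^sub>p\<close> for every \<open>p \<in> X\<^sub>a\<close> and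
  \<open>v p = 0\<close> elsewhere. The locally measure space is complete, so changing sections on null sets
  preserves integrability of the pairings; hence every member of \<open>\<D>\<close> agrees almost everywhere
  with a member of some \<open>level a\<close>. By the maximality condition (3) each \<open>level a\<close> is closed under the
  pointwise operations, and a Riesz--Fischer argument shows that its classes form a Hilbert space.
  These Hilbert spaces increase with \<open>a\<close>, carry the restricted inner product, and exhaust the
  direct integral.
\<close>

section \<open>Subspaces of inner product spaces\<close>

text \<open>The fibres come with no measurable structure: a section is controlled only through its
  pairings with the members of \<open>\<D>\<close>, and condition (3) is the only source of new
  members. A pointwise limit of sections therefore has to be tested against every \<open>w\<close>
  in \<open>\<D>\<close>. Its pairing is measurable as an almost everywhere limit of pairings, and
  it is dominated because condition (2), applied to \<open>w\<close> with itself, makes the squared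
  norm of \<open>w\<close> integrable.

  The index has to be fixed before limits are taken. A fibre \<open>D p\<close> is a union of stages
  and need not be complete, whereas each stage \<open>E p a\<close> is. A Cauchy sequence within one
  level has its pointwise limits in that same stage, so completeness is claimed level by level and
  not for the whole direct integral.\<close>

lemma cring_complex_field: "cring complex_field"
  by (rule cring_from_type_algebra)

text \<open>Additive inverses come from \<open>(-1) \<odot> x\<close>: distributivity together with
  the laws for the scalars \<open>0\<close> and \<open>1\<close> makes it the negative of
  \<open>x\<close>. What remains are closure, identities and positivity, which can be checked on
  representatives.\<close>

lemma complex_ip_spaceI:
  fixes V :: "'a ip_space" (structure)
  assumes "\<zero> \<in> carrier V"
    and "\<And>x y. x \<in> carrier V \<Longrightarrow> y \<in> carrier V \<Longrightarrow> x \<oplus> y \<in> carrier V"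
    and smult_closed: "\<And>c x. x \<in> carrier V \<Longrightarrow> c \<odot> x \<in> carrier V"
    and "\<And>x y z. x \<in> carrier V \<Longrightarrow> y \<in> carrier V \<Longrightarrow> z \<in> carrier V \<Longrightarrow> (x \<oplus> y) \<oplus> z = x \<oplus> (y \<oplus> z)"
    and "\<And>x y. x \<in> carrier V \<Longrightarrow> y \<in> carrier V \<Longrightarrow> x \<oplus> y = y \<oplus> x"
    and "\<And>x. x \<in> carrier V \<Longrightarrow> \<zero> \<oplus> x = x"
    and l_null: "\<And>x. x \<in> carrier V \<Longrightarrow> 0 \<odot> x = \<zero>"
    and one: "\<And>x. x \<in> carrier V \<Longrightarrow> 1 \<odot> x = x"
    and l_distr: "\<And>c d x. x \<in> carrier V \<Longrightarrow> (c + d) \<odot> x = c \<odot> x \<oplus> d \<odot> x"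
    and "\<And>c x y. x \<in> carrier V \<Longrightarrow> y \<in> carrier V \<Longrightarrow> c \<odot> (x \<oplus> y) = c \<odot> x \<oplus> c \<odot> y"
    and "\<And>c d x. x \<in> carrier V \<Longrightarrow> (c * d) \<odot> x = c \<odot> (d \<odot> x)"
    and "\<And>x y z. x \<in> carrier V \<Longrightarrow> y \<in> carrier V \<Longrightarrow> z \<in> carrier V \<Longrightarrow>
      ip V (x \<oplus> y) z = ip V x z + ip V y z"
    and "\<And>c x y. x \<in> carrier V \<Longrightarrow> y \<in> carrier V \<Longrightarrow> ip V (c \<odot> x) y = c * ip V x y"
    and "\<And>x y. x \<in> carrier V \<Longrightarrow> y \<in> carrier V \<Longrightarrow> ip V y x = cnj (ip V x y)"
    and "\<And>x. x \<in> carrier V \<Longrightarrow> 0 \<le> Re (ip V x x)"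
    and "\<And>x. x \<in> carrier V \<Longrightarrow> ip V x x = 0 \<Longrightarrow> x = \<zero>"
  shows "complex_ip_space V"
proof -
  have neg: "(-1) \<odot> x \<oplus> x = \<zero>" if "x \<in> carrier V" for x
    using that l_distr[of x "-1" 1] by (simp add: l_null one)
  have "abelian_group V"
    by (intro abelian_groupI bexI[of _ "(-1) \<odot> _"]) (fact assms(2) assms(1) assms(4-6) neg smult_closed)+
  then have "Module.module complex_field V"
    by (rule moduleI[OF cring_complex_field]; unfold complex_field_simps) (rule assms; assumption)+
  then show ?thesis
    by (rule complex_ip_space.intro[OF _ complex_ip_space_axioms.intro]) (rule assms; assumption)+
qed

lemma isometric_inclusionD:
  assumes "isometric_inclusion V W"
  shows "x \<in> carrier V \<Longrightarrow> x \<in> carrier W" "\<zero>\<^bsub>V\<^esub> = \<zero>\<^bsub>W\<^esub>"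
    "x \<in> carrier V \<Longrightarrow> y \<in> carrier V \<Longrightarrow> x \<oplus>\<^bsub>V\<^esub> y = x \<oplus>\<^bsub>W\<^esub> y"
    "x \<in> carrier V \<Longrightarrow> c \<odot>\<^bsub>V\<^esub> x = c \<odot>\<^bsub>W\<^esub> x"
    "x \<in> carrier V \<Longrightarrow> y \<in> carrier V \<Longrightarrow> ip V x y = ip W x y"
  using assms by (auto simp: isometric_inclusion_def)

text \<open>Identities and positivity pass down the inclusion, so only closure has to be checked.
  This serves twice: for \<open>D\<close> inside \<open>H\<close>, and for the classes of one level
  inside the direct integral.\<close>

lemma complex_ip_space_subspace:
  fixes V W :: "'a ip_space"
  assumes W: "complex_ip_space W" and inc: "isometric_inclusion V W"
    and zero: "\<zero>\<^bsub>W\<^esub> \<in> carrier V"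
    and add: "\<And>x y. x \<in> carrier V \<Longrightarrow> y \<in> carrier V \<Longrightarrow> x \<oplus>\<^bsub>W\<^esub> y \<in> carrier V"
    and smult: "\<And>c x. x \<in> carrier V \<Longrightarrow> c \<odot>\<^bsub>W\<^esub> x \<in> carrier V"
  shows "complex_ip_space V"
proof -
  interpret W: complex_ip_space W by fact
  note inc' = isometric_inclusionD[OF inc]
  note simps = inc' zero add smult W.smult_closed'
  show ?thesis
  proof (rule complex_ip_spaceI)
    fix c d x y z
    show "\<zero>\<^bsub>V\<^esub> \<in> carrier V" by (simp add: simps)
    assume x: "x \<in> carrier V"
    show "c \<odot>\<^bsub>V\<^esub> x \<in> carrier V" using x by (simp add: simps)
    show "\<zero>\<^bsub>V\<^esub> \<oplus>\<^bsub>V\<^esub> x = x" using x by (simp add: simps)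
    show "0 \<odot>\<^bsub>V\<^esub> x = \<zero>\<^bsub>V\<^esub>"
      using x W.smult_l_null[of x] by (simp add: simps complex_field_simps)
    show "1 \<odot>\<^bsub>V\<^esub> x = x" using x W.smult_one[of x] by (simp add: simps complex_field_simps)
    show "(c + d) \<odot>\<^bsub>V\<^esub> x = c \<odot>\<^bsub>V\<^esub> x \<oplus>\<^bsub>V\<^esub> d \<odot>\<^bsub>V\<^esub> x"
      using x W.smult_l_distr[of c d x] by (simp add: simps complex_field_simps)
    show "(c * d) \<odot>\<^bsub>V\<^esub> x = c \<odot>\<^bsub>V\<^esub> (d \<odot>\<^bsub>V\<^esub> x)"
      using x W.smult_assoc1[of c d x] by (simp add: simps complex_field_simps)
    show "0 \<le> Re (ip V x x)" using x by (simp add: simps W.ip_nonneg)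
    show "ip V x x = 0 \<Longrightarrow> x = \<zero>\<^bsub>V\<^esub>" using x W.ip_definite[of x] by (simp add: simps)
    assume y: "y \<in> carrier V"
    show "x \<oplus>\<^bsub>V\<^esub> y \<in> carrier V" using x y by (simp add: simps)
    show "x \<oplus>\<^bsub>V\<^esub> y = y \<oplus>\<^bsub>V\<^esub> x" using x y by (simp add: simps W.M.a_comm[of x y])
    show "c \<odot>\<^bsub>V\<^esub> (x \<oplus>\<^bsub>V\<^esub> y) = c \<odot>\<^bsub>V\<^esub> x \<oplus>\<^bsub>V\<^esub> c \<odot>\<^bsub>V\<^esub> y"
      using x y W.smult_r_distr[of c x y] by (simp add: simps complex_field_simps)
    show "ip V (c \<odot>\<^bsub>V\<^esub> x) y = c * ip V x y" using x y by (simp add: simps W.ip_smult_left)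
    show "ip V y x = cnj (ip V x y)" using x y W.ip_commute[of x y] by (simp add: simps)
    assume z: "z \<in> carrier V"
    show "x \<oplus>\<^bsub>V\<^esub> y \<oplus>\<^bsub>V\<^esub> z = x \<oplus>\<^bsub>V\<^esub> (y \<oplus>\<^bsub>V\<^esub> z)"
      using x y z by (simp add: simps W.M.a_assoc)
    show "ip V (x \<oplus>\<^bsub>V\<^esub> y) z = ip V x z + ip V y z"
      using x y z by (simp add: simps W.ip_add_left)
  qed
qed

section \<open>Cauchy--Schwarz and distances in inner product spaces\<close>

context complex_ip_space
begin

lemma minus_eq_smult: "x \<in> carrier V \<Longrightarrow> y \<in> carrier V \<Longrightarrow> x \<ominus> y = x \<oplus> (-1) \<odot> y"
  by (simp add: M.minus_eq smult_minus_one)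

lemma ip_dist_sq:
  "x \<in> carrier V \<Longrightarrow> y \<in> carrier V \<Longrightarrow>
    (ip_dist V x y)\<^sup>2 = Re (ip V (x \<oplus> (-1) \<odot> y) (x \<oplus> (-1) \<odot> y))"
  using ip_nonneg[of "x \<oplus> (-1) \<odot> y"]
  by (simp add: ip_dist_def ip_norm_def minus_eq_smult smult_closed')

lemma ip_zero_right: "y \<in> carrier V \<Longrightarrow> ip V y \<zero> = 0"
  using ip_add_right[of y \<zero> \<zero>] by simp

lemma cmod_ip_le:
  assumes "x \<in> carrier V" "y \<in> carrier V"
  shows "cmod (ip V x y) \<le> ip_norm V x * ip_norm V y"
proof -
  \<comment> \<open>Multiplying by the conjugate phase makes the pairing real, so the estimate for
    real parts applies. If the pairing is \<open>0\<close>, so is \<open>c\<close>; hence only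
    \<open>cmod c \<le> 1\<close> is used.\<close>
  define c where "c = cnj (sgn (ip V x y))"
  have "c * ip V x y = of_real (cmod (ip V x y))"
    by (cases "ip V x y = 0")
      (simp_all add: c_def sgn_div_norm scaleR_conv_of_real complex_norm_square[symmetric]
        mult.commute power2_eq_square divide_simps flip: of_real_mult)
  then have "cmod (ip V x y) = Re (ip V (c \<odot> x) y)"
    using assms by (simp add: ip_smult_left)
  also have "\<dots> \<le> cmod c * ip_norm V x * ip_norm V y"
    using Re_ip_le[of "c \<odot> x" y] assms by (simp add: smult_closed' ip_norm_smult)
  also have "cmod c * ip_norm V x * ip_norm V y \<le> 1 * ip_norm V x * ip_norm V y"
    using assms by (intro mult_right_mono) (auto simp: ip_norm_nonneg c_def norm_sgn)
  finally show ?thesis by simp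
qed

text \<open>Continuity of the pairing with an explicit modulus: it gives both the pointwise limits
  of pairings and their integrable bound.\<close>

lemma cmod_ip_diff_right_le:
  assumes "w \<in> carrier V" "x \<in> carrier V" "y \<in> carrier V"
  shows "cmod (ip V w x - ip V w y) \<le> ip_norm V w * ip_dist V x y"
proof -
  have "ip V w x - ip V w y = ip V w (x \<ominus> y)"
    using assms by (simp add: minus_eq_smult ip_add_right ip_smult_right smult_closed')
  then show ?thesis using cmod_ip_le[of w "x \<ominus> y"] assms by (simp add: ip_dist_def)
qed

end

text \<open>Negatives are determined by the carrier of each structure, so subtraction is not among
  the operations compared by an isometric inclusion. Writing it with \<open>(-1) \<odot> y\<close>
  reduces it to operations that are.\<close>

lemma isometric_inclusion_ip_dist:
  assumes "complex_ip_space V" "complex_ip_space W" "isometric_inclusion V W"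
    and "x \<in> carrier V" "y \<in> carrier V"
  shows "ip_dist V x y = ip_dist W x y"
proof -
  interpret V: complex_ip_space V by fact
  interpret W: complex_ip_space W by fact
  note inc = isometric_inclusionD[OF assms(3)]
  have "(-1) \<odot>\<^bsub>W\<^esub> y \<in> carrier V"
    using V.smult_closed'[of y "-1"] assms(5) by (simp add: inc(4))
  moreover from this have "x \<oplus>\<^bsub>W\<^esub> (-1) \<odot>\<^bsub>W\<^esub> y \<in> carrier V"
    using V.M.a_closed[OF assms(4)] assms(4) by (simp add: inc(3))
  ultimately show ?thesis
    using assms(4,5)
    by (simp add: ip_dist_def ip_norm_def V.minus_eq_smult W.minus_eq_smult inc)
qed

lemma isometric_inclusion_mono_carrier:
  "C \<subseteq> C' \<Longrightarrow> isometric_inclusion (V\<lparr>carrier := C\<rparr>) (V\<lparr>carrier := C'\<rparr>)"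
  by (auto simp: isometric_inclusion_def)

text \<open>\<open>D\<close> lies isometrically in \<open>H\<close>, so it inherits the axioms once
  it is closed under the operations. For sums, directedness puts both vectors in one stage.\<close>

lemma quantized_domainD:
  fixes E :: "'i::directed_order \<Rightarrow> 'a ip_space"
  assumes "quantized_domain H E D"
  shows "hilbert_space (E a)" "a \<le> b \<Longrightarrow> carrier (E a) \<subseteq> carrier (E b)"
    "isometric_inclusion (E a) D" "complex_ip_space D"
proof -
  have E: "strictly_inductive_system E" and D: "inductive_limit E D"
    and H: "hilbert_space H" "isometric_inclusion D H"
    using assms by (auto simp: quantized_domain_def)
  show hil: "hilbert_space (E a)" for a using E by (auto simp: strictly_inductive_system_def)
  show mono: "a \<le> b \<Longrightarrow> carrier (E a) \<subseteq> carrier (E b)" for a b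
    using E by (auto simp: strictly_inductive_system_def isometric_inclusion_def)
  show inc: "isometric_inclusion (E a) D" for a using D by (auto simp: inductive_limit_def)
  note incE = isometric_inclusionD[OF inc] and incH = isometric_inclusionD[OF H(2)]
  have ips: "complex_ip_space (E a)" for a using hil by (rule hilbert_space.axioms)
  have carr: "carrier D = (\<Union>a. carrier (E a))" using D by (auto simp: inductive_limit_def)
  show "complex_ip_space D"
  proof (rule complex_ip_space_subspace[OF _ H(2)])
    show "complex_ip_space H" using H(1) by (rule hilbert_space.axioms)
    fix a :: 'i
    interpret complex_ip_space "E a" by (rule ips)
    show "\<zero>\<^bsub>H\<^esub> \<in> carrier D" using M.zero_closed by (auto simp: carr incE incH)
  next
    fix x y assume xy: "x \<in> carrier D" "y \<in> carrier D"
    then obtain a b where "x \<in> carrier (E a)" "y \<in> carrier (E b)" by (auto simp: carr)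
    moreover obtain c where "a \<le> c" "b \<le> c" using directed by blast
    ultimately have c: "x \<in> carrier (E c)" "y \<in> carrier (E c)" using mono by blast+
    interpret complex_ip_space "E c" by (rule ips)
    have "x \<oplus>\<^bsub>E c\<^esub> y \<in> carrier D" using M.a_closed[OF c] by (auto simp: carr)
    then show "x \<oplus>\<^bsub>H\<^esub> y \<in> carrier D" using c xy by (simp add: incE incH)
  next
    fix k x assume x: "x \<in> carrier D"
    then obtain c where c: "x \<in> carrier (E c)" by (auto simp: carr)
    interpret complex_ip_space "E c" by (rule ips)
    have "k \<odot>\<^bsub>E c\<^esub> x \<in> carrier D" using smult_closed'[OF c] by (auto simp: carr)
    then show "k \<odot>\<^bsub>H\<^esub> x \<in> carrier D" using c x by (simp add: incE incH)
  qed
qed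

section \<open>Complete metric spaces\<close>

context Metric_space
begin

text \<open>A Cauchy sequence converges as soon as one subsequence does, and a subsequence can be
  chosen with increments as small as prescribed.\<close>

lemma mcompleteI_fast:
  fixes e :: "nat \<Rightarrow> real"
  assumes e: "\<And>n. 0 < e n"
    and lim: "\<And>\<sigma>. range \<sigma> \<subseteq> M \<Longrightarrow> (\<And>n. d (\<sigma> n) (\<sigma> (Suc n)) < e n) \<Longrightarrow>
      \<exists>x. limitin mtopology \<sigma> x sequentially"
  shows mcomplete
  unfolding mcomplete_def
proof (intro allI impI)
  fix \<sigma> assume \<sigma>: "MCauchy \<sigma>"
  have "\<exists>N. \<forall>n n'. N \<le> n \<longrightarrow> N \<le> n' \<longrightarrow> d (\<sigma> n) (\<sigma> n') < e k" for k
    using \<sigma> e by (auto simp: MCauchy_def)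
  then obtain N where N: "\<And>k n n'. N k \<le> n \<Longrightarrow> N k \<le> n' \<Longrightarrow> d (\<sigma> n) (\<sigma> n') < e k"
    by metis
  \<comment> \<open>Partial sums of \<open>Suc (N i)\<close> increase strictly and satisfy
    \<open>N k \<le> r k\<close>, whether or not \<open>N\<close> is monotone.\<close>
  define r where "r k = (\<Sum>i\<le>k. Suc (N i))" for k
  have r: "strict_mono r" by (rule strict_monoI_Suc) (simp add: r_def)
  have Nr: "N k \<le> r k" for k by (cases k) (auto simp: r_def)
  have "\<exists>x. limitin mtopology (\<sigma> \<circ> r) x sequentially"
  proof (rule lim)
    show "range (\<sigma> \<circ> r) \<subseteq> M" using \<sigma> by (auto simp: MCauchy_def)
    fix n
    have "r n \<le> r (Suc n)" using r by (simp add: strict_mono_less_eq)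
    then show "d ((\<sigma> \<circ> r) n) ((\<sigma> \<circ> r) (Suc n)) < e n"
      using N[of n "r n" "r (Suc n)"] Nr[of n] by simp
  qed
  then show "\<exists>x. limitin mtopology \<sigma> x sequentially"
    using MCauchy_convergent_subsequence[OF \<sigma> r] by blast
qed

text \<open>The subtracted \<open>(1/2) ^ n\<close> makes the induction close: each new increment
  uses up half of the remaining \<open>2 * C * (1/2) ^ n\<close>.\<close>

lemma geometric_dist_le:
  assumes x: "range x \<subseteq> M" and d: "\<And>k. d (x k) (x (Suc k)) \<le> C * (1/2) ^ k" and "m \<le> n"
  shows "d (x m) (x n) \<le> 2 * C * ((1/2) ^ m - (1/2) ^ n)"
  using \<open>m \<le> n\<close>
proof (induction n rule: dec_induct)
  case base
  have "x m \<in> M" using x by auto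
  then show ?case by simp
next
  case (step n)
  have "d (x m) (x (Suc n)) \<le> d (x m) (x n) + d (x n) (x (Suc n))"
    using x by (intro triangle) auto
  also have "\<dots> \<le> 2 * C * ((1/2) ^ m - (1/2) ^ n) + C * (1/2) ^ n" using step.IH d by (intro add_mono)
  finally show ?case by (simp add: algebra_simps)
qed

text \<open>The rate matters as much as the limit: applied fibre by fibre, it bounds the distance to
  the limit by a function of the point times \<open>(1/2) ^ k\<close>, which can be
  integrated.\<close>

lemma mcomplete_geometric:
  assumes mcomplete and x: "range x \<subseteq> M" and d: "\<And>k. d (x k) (x (Suc k)) \<le> C * (1/2) ^ k"
  shows "\<exists>l\<in>M. \<forall>k. d (x k) l \<le> 2 * C * (1/2) ^ k"
proof -
  have C: "0 \<le> C" using order_trans[OF nonneg d[of 0]] by simp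
  have le: "d (x m) (x n) \<le> 2 * C * (1/2) ^ m" if "m \<le> n" for m n
  proof -
    have "0 \<le> 2 * C * (1/2) ^ n" using C by simp
    then show ?thesis using geometric_dist_le[OF x d that] by (simp add: right_diff_distrib)
  qed
  have "MCauchy x"
    unfolding MCauchy_def
  proof (intro conjI allI impI x)
    fix \<epsilon> :: real assume "0 < \<epsilon>"
    have "(\<lambda>k. 2 * C * (1/2) ^ k) \<longlonglongrightarrow> 2 * C * 0"
      by (intro tendsto_intros) auto
    then have "eventually (\<lambda>k. 2 * C * (1/2) ^ k < \<epsilon>) sequentially"
      using \<open>0 < \<epsilon>\<close> by (auto dest: order_tendstoD(2))
    then obtain N where N: "\<And>k. N \<le> k \<Longrightarrow> 2 * C * (1/2) ^ k < \<epsilon>"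
      by (auto simp: eventually_sequentially)
    show "\<exists>N. \<forall>n n'. N \<le> n \<longrightarrow> N \<le> n' \<longrightarrow> d (x n) (x n') < \<epsilon>"
    proof (intro exI allI impI)
      fix n n' assume "N \<le> n" "N \<le> n'"
      then show "d (x n) (x n') < \<epsilon>"
        using le[of n n'] le[of n' n] N[of n] N[of n'] by (cases "n \<le> n'") (auto simp: commute)
    qed
  qed
  then obtain l where l: "limitin mtopology x l sequentially"
    using \<open>mcomplete\<close> by (auto simp: mcomplete_def)
  have lM: "l \<in> M" using l limitin_mspace by blast
  have "d (x k) l \<le> 2 * C * (1/2) ^ k" for k
  proof (rule field_le_epsilon)
    fix \<epsilon> :: real assume "0 < \<epsilon>"
    then obtain N where N: "\<And>n. N \<le> n \<Longrightarrow> d (x n) l < \<epsilon>"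
      using l unfolding limit_metric_sequentially by blast
    let ?n = "max N k"
    have "d (x k) l \<le> d (x k) (x ?n) + d (x ?n) l" using x lM by (intro triangle) auto
    also have "\<dots> \<le> 2 * C * (1/2) ^ k + \<epsilon>" using le[of k ?n] N[of ?n] by simp
    finally show "d (x k) l \<le> 2 * C * (1/2) ^ k + \<epsilon>" .
  qed
  then show ?thesis using lM by blast
qed

end

section \<open>Classes of sections\<close>

text \<open>The measure is the supremum over the traces on the \<open>space (M a)\<close>, so every
  trace of a null set is null. Subsets of these traces are measurable because each
  \<open>M a\<close> is a completion, and membership in \<open>loc_sets M\<close> is tested on
  traces.\<close>

lemma (in locally_measure_system) complete_loc_measure: "complete_measure (loc_measure M)"
proof
  fix A B assume BA: "B \<subseteq> A" and "A \<in> null_sets (loc_measure M)"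
  then have A: "A \<in> loc_sets M" and "loc_emeasure M A = 0"
    by (auto simp: null_sets_def sets_loc_measure emeasure_loc_measure)
  then have 0: "emeasure (M a) (A \<inter> space (M a)) = 0" for a
    by (simp add: loc_emeasure_eq_SUP flip: bot_ennreal)
  have "B \<inter> space (M a) \<in> sets (M a)" for a
  proof -
    obtain N where N: "M a = completion N" using completed_borel[of a] by blast
    have "A \<inter> space (M a) \<in> null_sets (M a)"
      using 0 A by (auto simp: null_sets_def loc_sets_def)
    moreover have "B \<inter> space (M a) \<subseteq> A \<inter> space (M a)" using BA by blast
    ultimately show ?thesis unfolding N by (rule completion.complete[rotated])
  qed
  then show "B \<in> sets (loc_measure M)"
    using BA A by (auto simp: sets_loc_measure loc_sets_def)
qed

text \<open>Preimages under \<open>f\<close> and \<open>g\<close> differ by a subset of a null set,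
  which is measurable here. Arbitrary choices of values on null sets thus become harmless.\<close>

lemma (in complete_measure) measurable_cong_AE:
  assumes f: "f \<in> measurable M N" and g: "\<And>x. x \<in> space M \<Longrightarrow> g x \<in> space N"
    and ae: "AE x in M. f x = g x"
  shows "g \<in> measurable M N"
proof (rule measurableI)
  fix A assume "A \<in> sets N"
  with f have A: "f -` A \<inter> space M \<in> sets M" by (rule measurable_sets)
  have "AE x in M. x \<in> f -` A \<inter> space M \<longleftrightarrow> x \<in> g -` A \<inter> space M"
    using ae by eventually_elim auto
  then show "g -` A \<inter> space M \<in> sets M" using A by (rule in_sets_AE) auto
qed (use g in auto)

section \<open>Fibres, sections and levels of a fixed direct integral\<close>

locale direct_integral_family = locally_measure_system T M
  for T :: "'i::directed_order \<Rightarrow> 'x topology" and M :: "'i \<Rightarrow> 'x measure" +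
  fixes H :: "'x \<Rightarrow> 'h ip_space"
    and E :: "'x \<Rightarrow> 'i \<Rightarrow> 'h ip_space"
    and D :: "'x \<Rightarrow> 'h ip_space"
    and \<D> :: "('x \<Rightarrow> 'h) set"
  assumes quantized: "p \<in> loc_space M \<Longrightarrow> quantized_domain (H p) (E p) (D p)"
    and direct_integral: "direct_integral M E D \<D>"
begin

sublocale loc: complete_measure "loc_measure M"
  by (rule complete_loc_measure)

abbreviation "V \<equiv> direct_integral_space M D \<D>"
abbreviation "cl \<equiv> ae_class M D"

lemmas fibre = quantized_domainD(4)[OF quantized]
lemmas stage_inclusion = quantized_domainD(3)[OF quantized]
lemmas stage_hilbert = quantized_domainD(1)[OF quantized]

lemma stage_ip_space: "p \<in> loc_space M \<Longrightarrow> complex_ip_space (E p a)"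
  by (rule hilbert_space.axioms(1)) (rule stage_hilbert)

lemma zero_in_stage: "p \<in> loc_space M \<Longrightarrow> \<zero>\<^bsub>D p\<^esub> \<in> carrier (E p a)"
proof -
  assume p: "p \<in> loc_space M"
  interpret Ep: complex_ip_space "E p a" using p by (rule stage_ip_space)
  show ?thesis
    using Ep.M.zero_closed isometric_inclusionD(2)[OF stage_inclusion[OF p, of a]] by simp
qed

lemma space_in_loc_space: "p \<in> space (M a) \<Longrightarrow> p \<in> loc_space M"
  by (auto simp: loc_space_def)

lemma AE_locI: "(\<And>p. p \<in> loc_space M \<Longrightarrow> P p) \<Longrightarrow> AE p in loc_measure M. P p"
  by (rule AE_I2) (simp add: space_loc_measure)

lemma integrable_cong_loc:
  "(\<And>p. p \<in> loc_space M \<Longrightarrow> f p = g p) \<Longrightarrow> integrable (loc_measure M) f \<longleftrightarrow> integrable (loc_measure M) g"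
  by (rule Bochner_Integration.integrable_cong) (simp_all add: space_loc_measure)

lemma integral_cong_loc:
  "(\<And>p. p \<in> loc_space M \<Longrightarrow> f p = g p) \<Longrightarrow> integral\<^sup>L (loc_measure M) f = integral\<^sup>L (loc_measure M) g"
  by (rule Bochner_Integration.integral_cong) (simp_all add: space_loc_measure)

lemma integrable_cong_AE_loc:
  fixes f g :: "'x \<Rightarrow> 'b::{banach, second_countable_topology}"
  assumes "integrable (loc_measure M) f" "AE p in loc_measure M. f p = g p"
  shows "integrable (loc_measure M) g"
proof (rule integrable_cong_AE_imp[OF assms(1) _ assms(2)])
  show "g \<in> borel_measurable (loc_measure M)"
    by (rule loc.measurable_cong_AE[OF borel_measurable_integrable[OF assms(1)] _ assms(2)]) simp
qed

lemma sections_carrier: "u \<in> sections M D \<Longrightarrow> p \<in> loc_space M \<Longrightarrow> u p \<in> carrier (D p)"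
  by (auto simp: sections_def)

lemma \<D>_sections: "u \<in> \<D> \<Longrightarrow> u \<in> sections M D"
  using direct_integral unfolding direct_integral_def by blast

lemma integrable_ip: "u \<in> \<D> \<Longrightarrow> v \<in> \<D> \<Longrightarrow> integrable (loc_measure M) (\<lambda>p. ip (D p) (u p) (v p))"
  using direct_integral unfolding direct_integral_def by blast

lemma \<D>I:
  assumes "v \<in> sections M D"
    and "\<forall>p\<in>space (M a). v p \<in> carrier (E p a)"
    and "\<forall>p\<in>loc_space M - space (M a). v p = \<zero>\<^bsub>D p\<^esub>"
    and "\<forall>w\<in>\<D>. integrable (loc_measure M) (\<lambda>p. ip (D p) (w p) (v p))"
  shows "v \<in> \<D>"
proof -
  have "(\<exists>a. (\<forall>p\<in>space (M a). v p \<in> carrier (E p a)) \<and>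
      (\<forall>p\<in>loc_space M - space (M a). v p = \<zero>\<^bsub>D p\<^esub>)) \<longrightarrow>
    (\<forall>w\<in>\<D>. integrable (loc_measure M) (\<lambda>p. ip (D p) (w p) (v p))) \<longrightarrow> v \<in> \<D>"
    by (rule bspec[OF direct_integral[unfolded direct_integral_def, THEN conjunct2, THEN conjunct2,
      THEN conjunct2] assms(1)])
  moreover have "\<exists>a. (\<forall>p\<in>space (M a). v p \<in> carrier (E p a)) \<and>
      (\<forall>p\<in>loc_space M - space (M a). v p = \<zero>\<^bsub>D p\<^esub>)"
    by (intro exI[of _ a] conjI assms(2,3))
  ultimately show ?thesis using assms(4) by (rule mp[THEN mp])
qed

text \<open>
  Condition (1) of the direct integral holds only almost everywhere, condition (3) asks for it
  everywhere on \<open>X\<^sub>a\<close>. The members of \<open>\<D>\<close> satisfying the stronger form are closed under pointwise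
  operations and represent all classes.
\<close>

definition level :: "'i \<Rightarrow> ('x \<Rightarrow> 'h) set"
  where "level a = {v \<in> \<D>. (\<forall>p\<in>space (M a). v p \<in> carrier (E p a)) \<and>
    (\<forall>p\<in>loc_space M - space (M a). v p = \<zero>\<^bsub>D p\<^esub>)}"

lemma level_\<D>: "u \<in> level a \<Longrightarrow> u \<in> \<D>"
  by (simp add: level_def)

lemma level_sections: "u \<in> level a \<Longrightarrow> u \<in> sections M D"
  by (simp add: level_def \<D>_sections)

lemma level_carrier: "u \<in> level a \<Longrightarrow> p \<in> loc_space M \<Longrightarrow> u p \<in> carrier (D p)"
  by (simp add: level_sections sections_carrier)

lemma levelD:
  "u \<in> level a \<Longrightarrow> p \<in> space (M a) \<Longrightarrow> u p \<in> carrier (E p a)"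
  "u \<in> level a \<Longrightarrow> p \<in> loc_space M \<Longrightarrow> p \<notin> space (M a) \<Longrightarrow> u p = \<zero>\<^bsub>D p\<^esub>"
  by (auto simp: level_def)

text \<open>Condition (3) in the form in which every new member of \<open>\<D>\<close> is produced.
  The pairing is tested against all of \<open>\<D>\<close>, not only against one level; restriction
  provides the extensionality of sections.\<close>

lemma levelI:
  assumes "\<And>p. p \<in> space (M a) \<Longrightarrow> f p \<in> carrier (E p a)"
    and "\<And>p. p \<in> loc_space M \<Longrightarrow> p \<notin> space (M a) \<Longrightarrow> f p = \<zero>\<^bsub>D p\<^esub>"
    and int: "\<And>w. w \<in> \<D> \<Longrightarrow> integrable (loc_measure M) (\<lambda>p. ip (D p) (w p) (f p))"
  shows "restrict f (loc_space M) \<in> level a"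
proof -
  let ?v = "restrict f (loc_space M)"
  have "f p \<in> carrier (D p)" if p: "p \<in> loc_space M" for p
  proof (cases "p \<in> space (M a)")
    case True
    then show ?thesis using assms(1) isometric_inclusionD(1)[OF stage_inclusion[OF p]] by blast
  next
    case False
    interpret F: complex_ip_space "D p" using p by (rule fibre)
    show ?thesis using assms(2) p False by simp
  qed
  then have sec: "?v \<in> sections M D" unfolding sections_def by (rule restrict_PiE_iff[THEN iffD2, OF ballI])
  have stage: "\<forall>p\<in>space (M a). ?v p \<in> carrier (E p a)"
    using assms(1) space_in_loc_space by simp
  have supp: "\<forall>p\<in>loc_space M - space (M a). ?v p = \<zero>\<^bsub>D p\<^esub>"
    using assms(2) by simp
  have "integrable (loc_measure M) (\<lambda>p. ip (D p) (w p) (?v p))" if "w \<in> \<D>" for w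
    by (rule integrable_cong_loc[THEN iffD1, OF _ int[OF that]]) simp
  then have "?v \<in> \<D>" by (intro \<D>I[OF sec stage supp] ballI)
  then show ?thesis using stage supp by (simp add: level_def)
qed

text \<open>On the part of \<open>space (M b)\<close> outside \<open>space (M a)\<close> the section
  vanishes, and zero belongs to every stage.\<close>

lemma level_mono: "a \<le> b \<Longrightarrow> level a \<subseteq> level b"
proof
  fix u assume ab: "a \<le> b" and u: "u \<in> level a"
  have "u p \<in> carrier (E p b)" if p: "p \<in> space (M b)" for p
  proof (cases "p \<in> space (M a)")
    case True
    then show ?thesis
      using levelD(1)[OF u] quantized_domainD(2)[OF quantized[OF space_in_loc_space[OF p]] ab] by blast
  next
    case False
    then show ?thesis
      using levelD(2)[OF u, of p] zero_in_stage[of p b] space_in_loc_space[OF p] by simp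
  qed
  moreover have "u p = \<zero>\<^bsub>D p\<^esub>" if "p \<in> loc_space M - space (M b)" for p
    using that levelD(2)[OF u] space_mono[OF ab] by blast
  ultimately show "u \<in> level b" using level_\<D>[OF u] by (simp add: level_def)
qed

lemma level_exists:
  assumes u: "u \<in> \<D>"
  obtains a v where "v \<in> level a" "AE p in loc_measure M. u p = v p"
proof -
  obtain a where ae: "AE p in loc_measure M. p \<in> space (M a) \<longrightarrow> u p \<in> carrier (E p a)"
    and supp: "{p \<in> loc_space M. u p \<noteq> \<zero>\<^bsub>D p\<^esub>} \<subseteq> space (M a)"
    using direct_integral[unfolded direct_integral_def, THEN conjunct2, THEN conjunct1] u by blast
  \<comment> \<open>Condition (1) locates the support of \<open>u\<close> everywhere, but its values
    in stage \<open>a\<close> only almost everywhere. The exceptional values inside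
    \<open>space (M a)\<close> are reset to zero, and outside nothing has to change.\<close>
  define f where "f p = (if p \<in> space (M a) \<and> u p \<notin> carrier (E p a) then \<zero>\<^bsub>D p\<^esub> else u p)" for p
  have uf: "AE p in loc_measure M. u p = f p"
    using ae by eventually_elim (auto simp: f_def)
  have "restrict f (loc_space M) \<in> level a"
  proof (rule levelI)
    show "f p \<in> carrier (E p a)" if "p \<in> space (M a)" for p
      using that zero_in_stage space_in_loc_space by (auto simp: f_def)
    show "f p = \<zero>\<^bsub>D p\<^esub>" if "p \<in> loc_space M" "p \<notin> space (M a)" for p
      using that supp by (auto simp: f_def)
    show "integrable (loc_measure M) (\<lambda>p. ip (D p) (w p) (f p))" if "w \<in> \<D>" for w
      using integrable_ip[OF that u] by (rule integrable_cong_AE_loc) (use uf in eventually_elim, simp)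
  qed
  moreover have "AE p in loc_measure M. u p = restrict f (loc_space M) p"
    using uf AE_space[of "loc_measure M"] by eventually_elim (simp add: space_loc_measure)
  ultimately show ?thesis by (rule that)
qed

section \<open>Pointwise operations on sections\<close>

definition pw_zero :: "'x \<Rightarrow> 'h"
  where "pw_zero = (\<lambda>p\<in>loc_space M. \<zero>\<^bsub>D p\<^esub>)"

definition pw_add :: "('x \<Rightarrow> 'h) \<Rightarrow> ('x \<Rightarrow> 'h) \<Rightarrow> 'x \<Rightarrow> 'h"
  where "pw_add u v = (\<lambda>p\<in>loc_space M. u p \<oplus>\<^bsub>D p\<^esub> v p)"

definition pw_smult :: "complex \<Rightarrow> ('x \<Rightarrow> 'h) \<Rightarrow> 'x \<Rightarrow> 'h"
  where "pw_smult c u = (\<lambda>p\<in>loc_space M. c \<odot>\<^bsub>D p\<^esub> u p)"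

lemma pw_apply:
  assumes "p \<in> loc_space M"
  shows "pw_zero p = \<zero>\<^bsub>D p\<^esub>" "pw_add u v p = u p \<oplus>\<^bsub>D p\<^esub> v p" "pw_smult c u p = c \<odot>\<^bsub>D p\<^esub> u p"
  using assms by (simp_all add: pw_zero_def pw_add_def pw_smult_def)

text \<open>Condition (3) admits the zero section at every level; in particular \<open>\<D>\<close>
  is not empty.\<close>

lemma pw_zero_level: "pw_zero \<in> level a"
  unfolding pw_zero_def
proof (rule levelI)
  show "integrable (loc_measure M) (\<lambda>p. ip (D p) (w p) \<zero>\<^bsub>D p\<^esub>)" if "w \<in> \<D>" for w
    using complex_ip_space.ip_zero_right[OF fibre] sections_carrier[OF \<D>_sections[OF that]]
    by (subst integrable_cong_loc[of _ "\<lambda>_. 0"]) auto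
qed (use zero_in_stage space_in_loc_space in auto)

lemma pw_add_level:
  assumes u: "u \<in> level a" and v: "v \<in> level a"
  shows "pw_add u v \<in> level a"
  unfolding pw_add_def
proof (rule levelI)
  fix p assume p: "p \<in> space (M a)"
  interpret Ep: complex_ip_space "E p a" using p by (intro stage_ip_space space_in_loc_space)
  show "u p \<oplus>\<^bsub>D p\<^esub> v p \<in> carrier (E p a)"
    using Ep.M.a_closed[of "u p" "v p"] levelD(1)[OF u p] levelD(1)[OF v p]
      isometric_inclusionD(3)[OF stage_inclusion[OF space_in_loc_space[OF p], of a]] by simp
next
  fix p assume p: "p \<in> loc_space M" "p \<notin> space (M a)"
  interpret F: complex_ip_space "D p" using p by (intro fibre)
  show "u p \<oplus>\<^bsub>D p\<^esub> v p = \<zero>\<^bsub>D p\<^esub>" using levelD(2)[OF u p] levelD(2)[OF v p] by simp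
next
  fix w assume w: "w \<in> \<D>"
  have "integrable (loc_measure M) (\<lambda>p. ip (D p) (w p) (u p) + ip (D p) (w p) (v p))"
    using integrable_ip[OF w] u v by (intro Bochner_Integration.integrable_add) (auto intro: level_\<D>)
  then show "integrable (loc_measure M) (\<lambda>p. ip (D p) (w p) (u p \<oplus>\<^bsub>D p\<^esub> v p))"
    using level_carrier[OF u] level_carrier[OF v] sections_carrier[OF \<D>_sections[OF w]]
    by (subst integrable_cong_loc[OF complex_ip_space.ip_add_right[OF fibre]])
qed

lemma pw_smult_level:
  assumes u: "u \<in> level a"
  shows "pw_smult c u \<in> level a"
  unfolding pw_smult_def
proof (rule levelI)
  fix p assume p: "p \<in> space (M a)"
  interpret Ep: complex_ip_space "E p a" using p by (intro stage_ip_space space_in_loc_space)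
  show "c \<odot>\<^bsub>D p\<^esub> u p \<in> carrier (E p a)"
    using Ep.smult_closed'[of "u p" c] levelD(1)[OF u p]
      isometric_inclusionD(4)[OF stage_inclusion[OF space_in_loc_space[OF p], of a]] by simp
next
  fix p assume p: "p \<in> loc_space M" "p \<notin> space (M a)"
  interpret F: complex_ip_space "D p" using p by (intro fibre)
  show "c \<odot>\<^bsub>D p\<^esub> u p = \<zero>\<^bsub>D p\<^esub>"
    using levelD(2)[OF u p] F.smult_r_null[of c] by (simp add: complex_field_simps)
next
  fix w assume w: "w \<in> \<D>"
  have "integrable (loc_measure M) (\<lambda>p. cnj c * ip (D p) (w p) (u p))"
    using integrable_ip[OF w level_\<D>[OF u]] by (rule integrable_mult_right)
  then show "integrable (loc_measure M) (\<lambda>p. ip (D p) (w p) (c \<odot>\<^bsub>D p\<^esub> u p))"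
    using level_carrier[OF u] sections_carrier[OF \<D>_sections[OF w]]
    by (subst integrable_cong_loc[OF complex_ip_space.ip_smult_right[OF fibre]])
qed

text \<open>Stated for sections because the representative chosen by \<open>ae_rep\<close> may lie
  outside every level, and even outside \<open>\<D>\<close>.\<close>

lemma pw_add_sections: "u \<in> sections M D \<Longrightarrow> v \<in> sections M D \<Longrightarrow> pw_add u v \<in> sections M D"
  unfolding pw_add_def sections_def
proof (rule restrict_PiE_iff[THEN iffD2, OF ballI])
  fix p assume uv: "u \<in> (\<Pi>\<^sub>E p\<in>loc_space M. carrier (D p))" "v \<in> (\<Pi>\<^sub>E p\<in>loc_space M. carrier (D p))"
    and p: "p \<in> loc_space M"
  interpret F: complex_ip_space "D p" using p by (rule fibre)
  show "u p \<oplus>\<^bsub>D p\<^esub> v p \<in> carrier (D p)" using PiE_mem[OF uv(1) p] PiE_mem[OF uv(2) p] by simp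
qed

lemma pw_smult_sections: "u \<in> sections M D \<Longrightarrow> pw_smult c u \<in> sections M D"
  using complex_ip_space.smult_closed'[OF fibre] by (auto simp: sections_def pw_smult_def)

section \<open>Operations on classes modulo null sets\<close>

lemma cl_eq_iff:
  assumes "u \<in> sections M D" "v \<in> sections M D"
  shows "cl u = cl v \<longleftrightarrow> (AE p in loc_measure M. u p = v p)"
proof
  assume "cl u = cl v"
  moreover have "v \<in> cl v" using assms by (simp add: ae_rel_def)
  ultimately have "v \<in> cl u" by simp
  then show "AE p in loc_measure M. u p = v p" by (simp add: ae_rel_def)
next
  assume uv: "AE p in loc_measure M. u p = v p"
  have "(AE p in loc_measure M. u p = w p) \<longleftrightarrow> (AE p in loc_measure M. v p = w p)" for w
    by (rule eventually_cong[OF uv]) simp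
  then show "cl u = cl v" using assms by (auto simp: ae_rel_def)
qed

lemma ae_rep_cl:
  assumes "u \<in> sections M D"
  shows "ae_rep (cl u) \<in> sections M D" "AE p in loc_measure M. ae_rep (cl u) p = u p"
proof -
  have "u \<in> cl u" using assms by (simp add: ae_rel_def)
  then have "ae_rep (cl u) \<in> cl u" unfolding ae_rep_def by (rule someI[where P = "\<lambda>x. x \<in> cl u"])
  then show "ae_rep (cl u) \<in> sections M D" "AE p in loc_measure M. ae_rep (cl u) p = u p"
    by (auto simp: ae_rel_def eq_commute)
qed

lemma zero_V: "\<zero>\<^bsub>V\<^esub> = cl pw_zero"
  by (simp add: direct_integral_space_def pw_zero_def)

lemma add_V:
  assumes "u \<in> sections M D" "v \<in> sections M D"
  shows "cl u \<oplus>\<^bsub>V\<^esub> cl v = cl (pw_add u v)"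
proof -
  note rep = ae_rep_cl[OF assms(1)] ae_rep_cl[OF assms(2)]
  have "cl u \<oplus>\<^bsub>V\<^esub> cl v = cl (pw_add (ae_rep (cl u)) (ae_rep (cl v)))"
    by (simp add: direct_integral_space_def pw_add_def)
  also have "\<dots> = cl (pw_add u v)"
  proof (subst cl_eq_iff)
    show "AE p in loc_measure M. pw_add (ae_rep (cl u)) (ae_rep (cl v)) p = pw_add u v p"
      using rep(2,4) by eventually_elim (simp add: pw_add_def restrict_def)
  qed (simp_all add: assms rep pw_add_sections)
  finally show ?thesis .
qed

lemma smult_V:
  assumes "u \<in> sections M D"
  shows "c \<odot>\<^bsub>V\<^esub> cl u = cl (pw_smult c u)"
proof -
  note rep = ae_rep_cl[OF assms]
  have "c \<odot>\<^bsub>V\<^esub> cl u = cl (pw_smult c (ae_rep (cl u)))"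
    by (simp add: direct_integral_space_def pw_smult_def)
  also have "\<dots> = cl (pw_smult c u)"
  proof (subst cl_eq_iff)
    show "AE p in loc_measure M. pw_smult c (ae_rep (cl u)) p = pw_smult c u p"
      using rep(2) by eventually_elim (simp add: pw_smult_def restrict_def)
  qed (simp_all add: assms rep pw_smult_sections)
  finally show ?thesis .
qed

lemma ip_V:
  assumes "u \<in> \<D>" "v \<in> \<D>"
  shows "ip V (cl u) (cl v) = (\<integral>p. ip (D p) (u p) (v p) \<partial>loc_measure M)"
proof -
  note rep = ae_rep_cl[OF \<D>_sections[OF assms(1)]] ae_rep_cl[OF \<D>_sections[OF assms(2)]]
  have ae: "AE p in loc_measure M. ip (D p) (u p) (v p) = ip (D p) (ae_rep (cl u) p) (ae_rep (cl v) p)"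
    using rep(2,4) by eventually_elim simp
  \<comment> \<open>Condition (2) does not speak about representatives outside \<open>\<D>\<close>;
    integrability reaches them through almost everywhere equality.\<close>
  have "integrable (loc_measure M) (\<lambda>p. ip (D p) (ae_rep (cl u) p) (ae_rep (cl v) p))"
    using integrable_ip[OF assms] ae by (rule integrable_cong_AE_loc)
  then have "(\<integral>p. ip (D p) (u p) (v p) \<partial>loc_measure M) =
      (\<integral>p. ip (D p) (ae_rep (cl u) p) (ae_rep (cl v) p) \<partial>loc_measure M)"
    using integrable_ip[OF assms] ae by (intro integral_cong_AE borel_measurable_integrable)
  then show ?thesis by (simp add: direct_integral_space_def)
qed

text \<open>The levels need not exhaust \<open>\<D>\<close>, but their classes exhaust the quotient.
  All later arguments may therefore use representatives that behave well at every point.\<close>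

lemma carrier_V: "carrier V = (\<Union>a. cl ` level a)"
proof
  show "carrier V \<subseteq> (\<Union>a. cl ` level a)"
  proof
    fix x assume "x \<in> carrier V"
    then obtain u where u: "u \<in> \<D>" "x = cl u"
      by (auto simp: direct_integral_space_def quotient_def)
    obtain a v where v: "v \<in> level a" "AE p in loc_measure M. u p = v p"
      using u(1) by (rule level_exists)
    then have "x = cl v" using u by (simp add: cl_eq_iff \<D>_sections level_sections)
    then show "x \<in> (\<Union>a. cl ` level a)" using v(1) by auto
  qed
  show "(\<Union>a. cl ` level a) \<subseteq> carrier V"
    by (auto simp: direct_integral_space_def quotient_def dest: level_\<D>)
qed

lemma V_cases:
  assumes "x \<in> carrier V"
  obtains a u where "u \<in> level a" "x = cl u"
  using assms unfolding carrier_V by auto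

text \<open>Directedness supplies a common level, where sums of representatives stay in one stage at
  every point.\<close>

lemma V_cases2:
  assumes "x \<in> carrier V" "y \<in> carrier V"
  obtains a u v where "u \<in> level a" "v \<in> level a" "x = cl u" "y = cl v"
proof -
  obtain a u where u: "u \<in> level a" "x = cl u" using assms(1) by (rule V_cases)
  obtain b v where v: "v \<in> level b" "y = cl v" using assms(2) by (rule V_cases)
  obtain c where "a \<le> c" "b \<le> c" using directed by blast
  then have "u \<in> level c" "v \<in> level c" using u v level_mono by blast+
  then show ?thesis using u v that by blast
qed

lemma V_cases3:
  assumes "x \<in> carrier V" "y \<in> carrier V" "z \<in> carrier V"
  obtains a u v w where "u \<in> level a" "v \<in> level a" "w \<in> level a" "x = cl u" "y = cl v" "z = cl w"
proof -
  obtain a u v where uv: "u \<in> level a" "v \<in> level a" "x = cl u" "y = cl v"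
    using assms(1,2) by (rule V_cases2)
  obtain b w where w: "w \<in> level b" "z = cl w" using assms(3) by (rule V_cases)
  obtain c where "a \<le> c" "b \<le> c" using directed by blast
  then have "u \<in> level c" "v \<in> level c" "w \<in> level c" using uv w level_mono by blast+
  then show ?thesis using uv w that by blast
qed

lemma cl_level_ops:
  assumes "u \<in> level a" "v \<in> level a"
  shows "cl u \<oplus>\<^bsub>V\<^esub> cl v = cl (pw_add u v)" "c \<odot>\<^bsub>V\<^esub> cl u = cl (pw_smult c u)"
    "ip V (cl u) (cl v) = (\<integral>p. ip (D p) (u p) (v p) \<partial>loc_measure M)"
  using assms by (auto simp: add_V smult_V ip_V level_sections level_\<D>)

lemma cl_level_carrier: "u \<in> level a \<Longrightarrow> cl u \<in> carrier V"
  by (auto simp: carrier_V)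

lemma cl_cong:
  assumes "u \<in> level a" "v \<in> level a" "\<And>p. p \<in> loc_space M \<Longrightarrow> u p = v p"
  shows "cl u = cl v"
  using assms by (simp add: cl_eq_iff level_sections AE_locI)

text \<open>With representatives in one level, each algebraic law reduces to the same law in the
  fibres, and the laws of the inner product follow by integration. Only definiteness needs the
  identification of sections modulo null sets.\<close>

lemma complex_ip_space_V: "complex_ip_space V"
proof (rule complex_ip_spaceI)
  note closed = pw_add_level pw_smult_level pw_zero_level
  fix c d x y z
  show "\<zero>\<^bsub>V\<^esub> \<in> carrier V" unfolding zero_V by (rule cl_level_carrier) (rule pw_zero_level)
  {
    assume "x \<in> carrier V"
    then obtain a u where u: "u \<in> level a" and x: "x = cl u" by (rule V_cases)
    note uc = level_carrier[OF u] and uu = cl_level_ops[OF u u]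
    show "c \<odot>\<^bsub>V\<^esub> x \<in> carrier V" using u by (auto simp: x uu intro: cl_level_carrier pw_smult_level)
    show "\<zero>\<^bsub>V\<^esub> \<oplus>\<^bsub>V\<^esub> x = x"
      unfolding x zero_V cl_level_ops(1)[OF pw_zero_level u]
    proof (rule cl_cong)
      fix p assume p: "p \<in> loc_space M"
      interpret F: complex_ip_space "D p" using p by (rule fibre)
      show "pw_add pw_zero u p = u p" using uc[OF p] p by (simp add: pw_apply)
    qed (auto intro: u closed)
    show "0 \<odot>\<^bsub>V\<^esub> x = \<zero>\<^bsub>V\<^esub>"
      unfolding x zero_V uu(2)
    proof (rule cl_cong)
      fix p assume p: "p \<in> loc_space M"
      interpret F: complex_ip_space "D p" using p by (rule fibre)
      show "pw_smult 0 u p = pw_zero p"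
        using F.smult_l_null[OF uc[OF p]] p by (simp add: pw_apply complex_field_simps)
    qed (auto intro: u closed)
    show "1 \<odot>\<^bsub>V\<^esub> x = x"
      unfolding x uu(2)
    proof (rule cl_cong)
      fix p assume p: "p \<in> loc_space M"
      interpret F: complex_ip_space "D p" using p by (rule fibre)
      show "pw_smult 1 u p = u p"
        using F.smult_one[OF uc[OF p]] p by (simp add: pw_apply complex_field_simps)
    qed (auto intro: u closed)
    show "(c + d) \<odot>\<^bsub>V\<^esub> x = c \<odot>\<^bsub>V\<^esub> x \<oplus>\<^bsub>V\<^esub> d \<odot>\<^bsub>V\<^esub> x"
      unfolding x uu(2) cl_level_ops(1)[OF pw_smult_level[OF u] pw_smult_level[OF u]]
    proof (rule cl_cong)
      fix p assume p: "p \<in> loc_space M"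
      interpret F: complex_ip_space "D p" using p by (rule fibre)
      show "pw_smult (c + d) u p = pw_add (pw_smult c u) (pw_smult d u) p"
        using F.smult_l_distr[of c d "u p"] uc[OF p] p by (simp add: pw_apply complex_field_simps)
    qed (auto intro: u closed)
    show "(c * d) \<odot>\<^bsub>V\<^esub> x = c \<odot>\<^bsub>V\<^esub> (d \<odot>\<^bsub>V\<^esub> x)"
      unfolding x uu(2) cl_level_ops(2)[OF pw_smult_level[OF u] pw_smult_level[OF u]]
    proof (rule cl_cong)
      fix p assume p: "p \<in> loc_space M"
      interpret F: complex_ip_space "D p" using p by (rule fibre)
      show "pw_smult (c * d) u p = pw_smult c (pw_smult d u) p"
        using F.smult_assoc1[of c d "u p"] uc[OF p] p by (simp add: pw_apply complex_field_simps)
    qed (auto intro: u closed)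
    note int = integrable_ip[OF level_\<D>[OF u] level_\<D>[OF u]]
    have Re: "Re (ip V x x) = (\<integral>p. Re (ip (D p) (u p) (u p)) \<partial>loc_measure M)"
      unfolding x uu(3) using int by simp
    have pos: "AE p in loc_measure M. 0 \<le> Re (ip (D p) (u p) (u p))"
      by (rule AE_locI) (rule complex_ip_space.ip_nonneg[OF fibre uc])
    show "0 \<le> Re (ip V x x)" unfolding Re using pos by (rule integral_nonneg_AE)
    \<comment> \<open>A nonnegative function with integral zero vanishes almost everywhere. Real
      parts suffice because \<open>ip (D p) (u p) (u p)\<close> is real.\<close>
    assume "ip V x x = 0"
    then have "AE p in loc_measure M. Re (ip (D p) (u p) (u p)) = 0"
      using Re int pos by (subst integral_nonneg_eq_0_iff_AE[symmetric]) auto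
    moreover have "AE p in loc_measure M. Re (ip (D p) (u p) (u p)) = 0 \<longrightarrow> u p = pw_zero p"
    proof (rule AE_locI)
      fix p assume p: "p \<in> loc_space M"
      interpret F: complex_ip_space "D p" using p by (rule fibre)
      show "Re (ip (D p) (u p) (u p)) = 0 \<longrightarrow> u p = pw_zero p"
        using F.ip_definite[OF uc[OF p]] F.Im_ip[OF uc[OF p]] p by (auto simp: pw_apply complex_eq_iff)
    qed
    ultimately have "AE p in loc_measure M. u p = pw_zero p" by eventually_elim simp
    then show "x = \<zero>\<^bsub>V\<^esub>" using u pw_zero_level by (simp add: x zero_V cl_eq_iff level_sections)
  }
  {
    assume "x \<in> carrier V" "y \<in> carrier V"
    then obtain a u v where u: "u \<in> level a" and v: "v \<in> level a" and xy: "x = cl u" "y = cl v"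
      by (rule V_cases2)
    note uc = level_carrier[OF u] and vc = level_carrier[OF v]
    show "x \<oplus>\<^bsub>V\<^esub> y \<in> carrier V"
      unfolding xy cl_level_ops(1)[OF u v] by (rule cl_level_carrier[OF pw_add_level[OF u v]])
    show "x \<oplus>\<^bsub>V\<^esub> y = y \<oplus>\<^bsub>V\<^esub> x"
      unfolding xy cl_level_ops(1)[OF u v] cl_level_ops(1)[OF v u]
    proof (rule cl_cong)
      fix p assume p: "p \<in> loc_space M"
      interpret F: complex_ip_space "D p" using p by (rule fibre)
      show "pw_add u v p = pw_add v u p"
        using F.M.a_comm[OF uc[OF p] vc[OF p]] p by (simp add: pw_apply)
    qed (auto intro: u v closed)
    show "c \<odot>\<^bsub>V\<^esub> (x \<oplus>\<^bsub>V\<^esub> y) = c \<odot>\<^bsub>V\<^esub> x \<oplus>\<^bsub>V\<^esub> c \<odot>\<^bsub>V\<^esub> y"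
      unfolding xy cl_level_ops(1)[OF u v] cl_level_ops(2)[OF u u] cl_level_ops(2)[OF v v]
        cl_level_ops(2)[OF pw_add_level[OF u v] u] cl_level_ops(1)[OF pw_smult_level[OF u] pw_smult_level[OF v]]
    proof (rule cl_cong)
      fix p assume p: "p \<in> loc_space M"
      interpret F: complex_ip_space "D p" using p by (rule fibre)
      show "pw_smult c (pw_add u v) p = pw_add (pw_smult c u) (pw_smult c v) p"
        using F.smult_r_distr[of c "u p" "v p"] uc[OF p] vc[OF p] p by (simp add: pw_apply complex_field_simps)
    qed (auto intro: u v closed)
    show "ip V (c \<odot>\<^bsub>V\<^esub> x) y = c * ip V x y"
    proof -
      have "ip V (c \<odot>\<^bsub>V\<^esub> x) y = (\<integral>p. c * ip (D p) (u p) (v p) \<partial>loc_measure M)"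
        unfolding xy cl_level_ops(2)[OF u u] cl_level_ops(3)[OF pw_smult_level[OF u] v]
        by (rule integral_cong_loc) (simp add: pw_apply complex_ip_space.ip_smult_left[OF fibre] uc vc)
      then show ?thesis by (simp add: xy cl_level_ops(3)[OF u v])
    qed
    show "ip V y x = cnj (ip V x y)"
    proof -
      have "ip V y x = (\<integral>p. cnj (ip (D p) (u p) (v p)) \<partial>loc_measure M)"
        unfolding xy cl_level_ops(3)[OF v u]
        by (rule integral_cong_loc) (rule complex_ip_space.ip_commute[OF fibre uc vc])
      then show ?thesis by (simp add: xy cl_level_ops(3)[OF u v])
    qed
  }
  assume "x \<in> carrier V" "y \<in> carrier V" "z \<in> carrier V"
  then obtain a u v w where u: "u \<in> level a" and v: "v \<in> level a" and w: "w \<in> level a"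
    and xyz: "x = cl u" "y = cl v" "z = cl w"
    by (rule V_cases3)
  note uc = level_carrier[OF u] and vc = level_carrier[OF v] and wc = level_carrier[OF w]
  note uv = pw_add_level[OF u v] and vw = pw_add_level[OF v w]
  show "x \<oplus>\<^bsub>V\<^esub> y \<oplus>\<^bsub>V\<^esub> z = x \<oplus>\<^bsub>V\<^esub> (y \<oplus>\<^bsub>V\<^esub> z)"
    unfolding xyz cl_level_ops(1)[OF u v] cl_level_ops(1)[OF v w]
      cl_level_ops(1)[OF u vw] cl_level_ops(1)[OF uv w]
  proof (rule cl_cong)
    fix p assume p: "p \<in> loc_space M"
    interpret F: complex_ip_space "D p" using p by (rule fibre)
    show "pw_add (pw_add u v) w p = pw_add u (pw_add v w) p"
      using F.M.a_assoc[OF uc[OF p] vc[OF p] wc[OF p]] p by (simp add: pw_apply)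
  qed (auto intro: u v w closed)
  show "ip V (x \<oplus>\<^bsub>V\<^esub> y) z = ip V x z + ip V y z"
  proof -
    have "ip V (x \<oplus>\<^bsub>V\<^esub> y) z =
        (\<integral>p. ip (D p) (u p) (w p) + ip (D p) (v p) (w p) \<partial>loc_measure M)"
      unfolding xyz cl_level_ops(1)[OF u v] cl_level_ops(3)[OF uv w]
      by (rule integral_cong_loc) (simp add: pw_apply complex_ip_space.ip_add_left[OF fibre] uc vc wc)
    also have "\<dots> = ip V x z + ip V y z"
      unfolding xyz cl_level_ops(3)[OF u w] cl_level_ops(3)[OF v w]
      by (intro Bochner_Integration.integral_add integrable_ip level_\<D>[OF u] level_\<D>[OF v] level_\<D>[OF w])
    finally show ?thesis .
  qed
qed

text \<open>The difference of two members of a level is again in that level, so its norm is the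
  \<open>L^2\<close> norm of the fibre distance. Squares keep roots out of the integral.\<close>

lemma ip_dist_V_sq:
  assumes u: "u \<in> level a" and v: "v \<in> level a"
  shows "integrable (loc_measure M) (\<lambda>p. (ip_dist (D p) (u p) (v p))\<^sup>2)"
    and "(ip_dist V (cl u) (cl v))\<^sup>2 = (\<integral>p. (ip_dist (D p) (u p) (v p))\<^sup>2 \<partial>loc_measure M)"
proof -
  interpret V: complex_ip_space V by (rule complex_ip_space_V)
  define w where "w = pw_add u (pw_smult (-1) v)"
  have w: "w \<in> level a" unfolding w_def by (intro pw_add_level pw_smult_level u v)
  note int = integrable_ip[OF level_\<D>[OF w] level_\<D>[OF w]]
  have eq: "(ip_dist (D p) (u p) (v p))\<^sup>2 = Re (ip (D p) (w p) (w p))" if p: "p \<in> loc_space M" for p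
    using complex_ip_space.ip_dist_sq[OF fibre[OF p] level_carrier[OF u p] level_carrier[OF v p]] p
    by (simp add: w_def pw_apply)
  show "integrable (loc_measure M) (\<lambda>p. (ip_dist (D p) (u p) (v p))\<^sup>2)"
    using int by (subst integrable_cong_loc[OF eq]) simp_all
  have "(ip_dist V (cl u) (cl v))\<^sup>2 = Re (ip V (cl w) (cl w))"
    unfolding V.ip_dist_sq[OF cl_level_carrier[OF u] cl_level_carrier[OF v]] w_def
      cl_level_ops(2)[OF v v] cl_level_ops(1)[OF u pw_smult_level[OF v]] ..
  also have "\<dots> = (\<integral>p. Re (ip (D p) (w p) (w p)) \<partial>loc_measure M)"
    unfolding cl_level_ops(3)[OF w w] using int by simp
  also have "\<dots> = (\<integral>p. (ip_dist (D p) (u p) (v p))\<^sup>2 \<partial>loc_measure M)"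
    by (rule integral_cong_loc) (simp add: eq)
  finally show "(ip_dist V (cl u) (cl v))\<^sup>2 = (\<integral>p. (ip_dist (D p) (u p) (v p))\<^sup>2 \<partial>loc_measure M)" .
qed

text \<open>Completeness is available in the stages, while the integrals involve the distance of
  \<open>D p\<close>; this passes between the two.\<close>

lemma stage_ip_dist:
  assumes "p \<in> loc_space M" "x \<in> carrier (E p a)" "y \<in> carrier (E p a)"
  shows "ip_dist (E p a) x y = ip_dist (D p) x y"
  using assms by (intro isometric_inclusion_ip_dist stage_ip_space fibre stage_inclusion)

subsection \<open>Completeness\<close>

text \<open>
  Riesz--Fischer. The weights \<open>4\<^sup>k\<close> make \<open>g\<close> integrable, and where \<open>g\<close> is finite they turn the
  increments into a geometric sequence with constant \<open>sqrt (g p)\<close>; the distance to the pointwise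
  limit is then dominated by \<open>2 sqrt (g p) / 2\<^sup>k\<close>.
\<close>

lemma level_geometric_limit:
  assumes u: "\<And>k. u k \<in> level a"
    and fast: "\<And>k. (ip_dist V (cl (u k)) (cl (u (Suc k))))\<^sup>2 \<le> (1/8) ^ k"
  obtains l B where "l \<in> level a" "\<And>k. (ip_dist V (cl (u k)) (cl l))\<^sup>2 \<le> B * (1/4) ^ k"
proof -
  let ?\<mu> = "loc_measure M"
  define h where "h k p = (ip_dist (D p) (u k p) (u (Suc k) p))\<^sup>2" for k p
  have h_int: "integrable ?\<mu> (h k)" and h_le: "integral\<^sup>L ?\<mu> (h k) \<le> (1/8) ^ k" for k
    using ip_dist_V_sq[OF u u, of k "Suc k"] fast[of k] by (simp_all add: h_def[abs_def])
  have h_nonneg: "0 \<le> h k p" for k p by (simp add: h_def)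
  have h_meas[measurable]: "h k \<in> borel_measurable ?\<mu>" for k
    using h_int by (rule borel_measurable_integrable)
  \<comment> \<open>The assumed rate \<open>(1/8) ^ k\<close> outweighs the factor
    \<open>4 ^ k\<close>: the integrals of the terms are at most \<open>(1/2) ^ k\<close>, hence
    summable.\<close>
  define g where "g p = (\<Sum>k. ennreal (4 ^ k * h k p))" for p
  have g_meas[measurable]: "g \<in> borel_measurable ?\<mu>" unfolding g_def[abs_def] by measurable
  have "(\<integral>\<^sup>+p. g p \<partial>?\<mu>) = (\<Sum>k. \<integral>\<^sup>+p. ennreal (4 ^ k * h k p) \<partial>?\<mu>)"
    unfolding g_def by (rule nn_integral_suminf) measurable
  also have "\<dots> \<le> (\<Sum>k. ennreal ((1/2) ^ k))"
  proof (rule suminf_le)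
    fix k
    have "(\<integral>\<^sup>+p. ennreal (4 ^ k * h k p) \<partial>?\<mu>) = ennreal (\<integral>p. 4 ^ k * h k p \<partial>?\<mu>)"
      using h_int h_nonneg by (intro nn_integral_eq_integral) auto
    also have "\<dots> \<le> ennreal (4 ^ k * (1/8) ^ k)"
      using h_le[of k] by (intro ennreal_leI) simp
    also have "4 ^ k * (1/8) ^ k = ((1/2) ^ k :: real)"
      unfolding power_mult_distrib[symmetric] by simp
    finally show "(\<integral>\<^sup>+p. ennreal (4 ^ k * h k p) \<partial>?\<mu>) \<le> ennreal ((1/2) ^ k)" .
  qed auto
  also have "\<dots> = ennreal (\<Sum>k. (1/2) ^ k)"
    by (intro suminf_ennreal2 summable_geometric) auto
  also have "\<dots> < \<infinity>" by simp
  finally have g_fin: "(\<integral>\<^sup>+p. g p \<partial>?\<mu>) < \<infinity>" .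
  then have g_AE: "AE p in ?\<mu>. g p \<noteq> \<infinity>" by (intro nn_integral_PInf_AE) auto
  \<comment> \<open>\<open>enn2real\<close> turns an infinite value into \<open>0\<close>, so the
    pointwise estimates below carry the hypothesis \<open>g p \<noteq> \<infinity>\<close>.\<close>
  define G where "G p = enn2real (g p)" for p
  have G_nonneg: "0 \<le> G p" for p by (simp add: G_def)
  have G_int: "integrable ?\<mu> G"
  proof (rule integrableI_nonneg)
    have "(\<integral>\<^sup>+p. ennreal (G p) \<partial>?\<mu>) = (\<integral>\<^sup>+p. g p \<partial>?\<mu>)"
      using g_AE by (intro nn_integral_cong_AE) (auto simp: G_def less_top elim!: eventually_mono)
    then show "(\<integral>\<^sup>+p. ennreal (G p) \<partial>?\<mu>) < \<infinity>" using g_fin by simp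
  qed (auto simp: G_nonneg G_def[abs_def])
  have hG: "h k p \<le> G p * (1/4) ^ k" if "g p \<noteq> \<infinity>" for k p
  proof -
    have "ennreal (4 ^ k * h k p) \<le> g p"
      unfolding g_def using sum_le_suminf[of "\<lambda>k. ennreal (4 ^ k * h k p)" "{k}"] by simp
    then have "ennreal (4 ^ k * h k p) \<le> ennreal (G p)" using that by (simp add: G_def less_top)
    then have "4 ^ k * h k p \<le> G p" using G_nonneg by (simp add: ennreal_le_iff)
    then show ?thesis by (simp add: field_simps)
  qed
  have "\<exists>l\<in>carrier (E p a). \<forall>k. ip_dist (D p) (u k p) l \<le> 2 * sqrt (G p) * (1/2) ^ k"
    if p: "p \<in> space (M a)" and gp: "g p \<noteq> \<infinity>" for p
  proof -
    have p': "p \<in> loc_space M" using p by (rule space_in_loc_space)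
    interpret Ep: hilbert_space "E p a" using p' by (rule stage_hilbert)
    interpret Metric_space "carrier (E p a)" "ip_dist (E p a)" by (rule Ep.Metric_space_ip_dist)
    note uE = levelD(1)[OF u p]
    have "\<exists>l\<in>carrier (E p a). \<forall>k. ip_dist (E p a) (u k p) l \<le> 2 * sqrt (G p) * (1/2) ^ k"
    proof (rule mcomplete_geometric[OF Ep.complete])
      show "range (\<lambda>k. u k p) \<subseteq> carrier (E p a)" using uE by auto
      fix k
      have "ip_dist (E p a) (u k p) (u (Suc k) p) = sqrt (h k p)"
        by (simp add: h_def stage_ip_dist[OF p' uE uE, symmetric])
      also have "\<dots> \<le> sqrt (G p * (1/4) ^ k)" using hG[OF gp] by simp
      also have "\<dots> = sqrt (G p) * (1/2) ^ k"
        using real_sqrt_power[of "1/4" k] by (simp add: real_sqrt_mult real_sqrt_divide)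
      finally show "ip_dist (E p a) (u k p) (u (Suc k) p) \<le> sqrt (G p) * (1/2) ^ k" .
    qed
    then obtain l where l: "l \<in> carrier (E p a)"
      and "\<And>k. ip_dist (E p a) (u k p) l \<le> 2 * sqrt (G p) * (1/2) ^ k" by blast
    then show ?thesis using stage_ip_dist[OF p' uE l] by auto
  qed
  then have "\<forall>p. \<exists>l. p \<in> space (M a) \<and> g p \<noteq> \<infinity> \<longrightarrow>
      l \<in> carrier (E p a) \<and> (\<forall>k. ip_dist (D p) (u k p) l \<le> 2 * sqrt (G p) * (1/2) ^ k)"
    by blast
  then obtain l0 where "\<forall>p. p \<in> space (M a) \<and> g p \<noteq> \<infinity> \<longrightarrow>
      l0 p \<in> carrier (E p a) \<and> (\<forall>k. ip_dist (D p) (u k p) (l0 p) \<le> 2 * sqrt (G p) * (1/2) ^ k)"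
    by (rule choice[THEN exE])
  then have l0: "\<And>p. p \<in> space (M a) \<Longrightarrow> g p \<noteq> \<infinity> \<Longrightarrow> l0 p \<in> carrier (E p a)"
    and l0_dist: "\<And>p k. p \<in> space (M a) \<Longrightarrow> g p \<noteq> \<infinity> \<Longrightarrow>
      ip_dist (D p) (u k p) (l0 p) \<le> 2 * sqrt (G p) * (1/2) ^ k"
    by blast+
  \<comment> \<open>Zero is forced outside \<open>space (M a)\<close>. Where \<open>g\<close> is
    infinite it is a safe default: it lies in stage \<open>a\<close>, so the everywhere requirement
    of condition (3) still holds.\<close>
  define f where "f p = (if p \<in> space (M a) \<and> g p \<noteq> \<infinity> then l0 p else \<zero>\<^bsub>D p\<^esub>)" for p
  have f_stage: "f p \<in> carrier (E p a)" if "p \<in> space (M a)" for p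
    using that l0 zero_in_stage[OF space_in_loc_space] by (auto simp: f_def)
  have f_carrier: "f p \<in> carrier (D p)" if p: "p \<in> loc_space M" for p
  proof (cases "p \<in> space (M a)")
    case True
    then show ?thesis using f_stage isometric_inclusionD(1)[OF stage_inclusion[OF p]] by blast
  next
    case False
    interpret F: complex_ip_space "D p" using p by (rule fibre)
    show ?thesis using False by (simp add: f_def)
  qed
  have f_dist: "ip_dist (D p) (u k p) (f p) \<le> 2 * sqrt (G p) * (1/2) ^ k"
    if p: "p \<in> loc_space M" and gp: "g p \<noteq> \<infinity>" for p k
  proof (cases "p \<in> space (M a)")
    case True
    then show ?thesis using l0_dist gp by (simp add: f_def)
  next
    case False
    interpret F: complex_ip_space "D p" using p by (rule fibre)
    interpret Metric_space "carrier (D p)" "ip_dist (D p)" by (rule F.Metric_space_ip_dist)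
    have "ip_dist (D p) (u k p) (f p) = 0"
      using False levelD(2)[OF u p] by (simp add: f_def)
    then show ?thesis using G_nonneg by simp
  qed
  have good: "AE p in ?\<mu>. p \<in> loc_space M \<and> g p \<noteq> \<infinity>"
    using g_AE AE_space[of ?\<mu>] by eventually_elim (simp add: space_loc_measure)
  define l where "l = restrict f (loc_space M)"
  have l: "l \<in> level a"
    unfolding l_def
  proof (rule levelI)
    show "f p = \<zero>\<^bsub>D p\<^esub>" if "p \<notin> space (M a)" for p using that by (simp add: f_def)
    fix w assume w: "w \<in> \<D>"
    note wc = sections_carrier[OF \<D>_sections[OF w]]
    note w_int = integrable_ip[OF w] integrable_ip[OF w level_\<D>[OF u]]
    have bound: "cmod (ip (D p) (w p) (u k p) - ip (D p) (w p) (f p)) \<le>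
        ip_norm (D p) (w p) * (2 * sqrt (G p) * (1/2) ^ k)"
      if p: "p \<in> loc_space M" and gp: "g p \<noteq> \<infinity>" for p k
    proof -
      interpret F: complex_ip_space "D p" using p by (rule fibre)
      have "cmod (ip (D p) (w p) (u k p) - ip (D p) (w p) (f p)) \<le>
          ip_norm (D p) (w p) * ip_dist (D p) (u k p) (f p)"
        by (rule F.cmod_ip_diff_right_le[OF wc[OF p] level_carrier[OF u p] f_carrier[OF p]])
      also have "\<dots> \<le> ip_norm (D p) (w p) * (2 * sqrt (G p) * (1/2) ^ k)"
        using f_dist[OF p gp] F.ip_norm_nonneg[OF wc[OF p]] by (rule mult_left_mono)
      finally show ?thesis .
    qed
    have lim: "(\<lambda>k. ip (D p) (w p) (u k p)) \<longlonglongrightarrow> ip (D p) (w p) (f p)"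
      if p: "p \<in> loc_space M" and gp: "g p \<noteq> \<infinity>" for p
    proof (rule LIM_zero_cancel, rule Lim_null_comparison)
      show "\<forall>\<^sub>F k in sequentially. cmod (ip (D p) (w p) (u k p) - ip (D p) (w p) (f p)) \<le>
          ip_norm (D p) (w p) * (2 * sqrt (G p) * (1/2) ^ k)"
        using bound[OF p gp] by simp
      have "(\<lambda>k. ip_norm (D p) (w p) * (2 * sqrt (G p) * (1/2) ^ k)) \<longlonglongrightarrow>
          ip_norm (D p) (w p) * (2 * sqrt (G p) * 0)"
        by (intro tendsto_intros) auto
      then show "(\<lambda>k. ip_norm (D p) (w p) * (2 * sqrt (G p) * (1/2) ^ k)) \<longlonglongrightarrow> 0" by simp
    qed
    \<comment> \<open>\<open>lim\<close> is a total operation that yields a measurable function. It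
      is the wanted pairing wherever \<open>g\<close> is finite, and completeness of the measure
      absorbs the rest.\<close>
    have meas: "(\<lambda>p. ip (D p) (w p) (f p)) \<in> borel_measurable ?\<mu>"
    proof (rule loc.measurable_cong_AE)
      show "(\<lambda>p. Topological_Spaces.lim (\<lambda>k. ip (D p) (w p) (u k p))) \<in> borel_measurable ?\<mu>"
        by (rule borel_measurable_lim_metric) (rule borel_measurable_integrable[OF w_int(2)])
      show "AE p in ?\<mu>. Topological_Spaces.lim (\<lambda>k. ip (D p) (w p) (u k p)) = ip (D p) (w p) (f p)"
        using good by eventually_elim (rule limI, blast intro: lim)
    qed simp
    \<comment> \<open>The bound at \<open>k = 0\<close> leaves the product of
      \<open>2 * sqrt (G p)\<close> and the norm of \<open>w p\<close>, which is at most
      \<open>G p\<close> plus the squared norm; the latter is integrable by condition (2).\<close>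
    have dom: "integrable ?\<mu> (\<lambda>p. cmod (ip (D p) (w p) (u 0 p)) + Re (ip (D p) (w p) (w p)) + G p)"
      using w_int(1)[OF w] w_int(2) G_int
      by (intro Bochner_Integration.integrable_add integrable_norm integrable_Re) auto
    show "integrable ?\<mu> (\<lambda>p. ip (D p) (w p) (f p))"
    proof (rule Bochner_Integration.integrable_bound[OF dom meas])
      show "AE p in ?\<mu>. norm (ip (D p) (w p) (f p)) \<le>
          norm (cmod (ip (D p) (w p) (u 0 p)) + Re (ip (D p) (w p) (w p)) + G p)"
        using good
      proof eventually_elim
        case (elim p)
        then have p: "p \<in> loc_space M" by simp
        interpret F: complex_ip_space "D p" using p by (rule fibre)
        let ?n = "ip_norm (D p) (w p)"
        have "cmod (ip (D p) (w p) (f p)) \<le> cmod (ip (D p) (w p) (u 0 p)) + ?n * (2 * sqrt (G p))"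
          using bound[of p 0] elim
            norm_triangle_ineq2[of "ip (D p) (w p) (f p)" "ip (D p) (w p) (u 0 p)"]
          by (simp add: norm_minus_commute)
        also have "?n * (2 * sqrt (G p)) \<le> ?n\<^sup>2 + G p"
          using sum_squares_bound[of ?n "sqrt (G p)"] G_nonneg[of p] by (simp add: algebra_simps)
        also have "?n\<^sup>2 = Re (ip (D p) (w p) (w p))"
          using F.ip_self[OF wc[OF p]] by simp
        finally show ?case by simp
      qed
    qed
  qed (use f_stage in auto)
  \<comment> \<open>The constant comes from squaring the pointwise bound
    \<open>2 * sqrt (G p) * (1/2) ^ k\<close> and integrating.\<close>
  have "(ip_dist V (cl (u k)) (cl l))\<^sup>2 \<le> (4 * integral\<^sup>L ?\<mu> G) * (1/4) ^ k" for k
  proof -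
    have "(ip_dist V (cl (u k)) (cl l))\<^sup>2 = (\<integral>p. (ip_dist (D p) (u k p) (l p))\<^sup>2 \<partial>?\<mu>)"
      by (rule ip_dist_V_sq(2)[OF u l])
    also have "\<dots> \<le> (\<integral>p. 4 * (1/4) ^ k * G p \<partial>?\<mu>)"
    proof (rule integral_mono_AE)
      show "AE p in ?\<mu>. (ip_dist (D p) (u k p) (l p))\<^sup>2 \<le> 4 * (1/4) ^ k * G p"
        using good
      proof eventually_elim
        case (elim p)
        then have p: "p \<in> loc_space M" and gp: "g p \<noteq> \<infinity>" by auto
        interpret F: complex_ip_space "D p" using p by (rule fibre)
        interpret Metric_space "carrier (D p)" "ip_dist (D p)" by (rule F.Metric_space_ip_dist)
        have "(ip_dist (D p) (u k p) (l p))\<^sup>2 \<le> (2 * sqrt (G p) * (1/2) ^ k)\<^sup>2"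
          using f_dist[OF p gp] p by (intro power_mono) (simp_all add: l_def)
        also have "\<dots> = 4 * ((1/2) ^ k)\<^sup>2 * G p"
          using G_nonneg[of p] by (simp only: power_mult_distrib real_sqrt_pow2) simp
        also have "((1/2) ^ k)\<^sup>2 = ((1/4) ^ k :: real)"
          unfolding power2_eq_square power_mult_distrib[symmetric] by simp
        finally show ?case .
      qed
    qed (use ip_dist_V_sq(1)[OF u l] G_int in auto)
    also have "\<dots> = (4 * integral\<^sup>L ?\<mu> G) * (1/4) ^ k" by simp
    finally show ?thesis .
  qed
  with l show ?thesis by (rule that)
qed

section \<open>The levels as Hilbert spaces and their limit\<close>

abbreviation "level_space a \<equiv> V\<lparr>carrier := cl ` level a\<rparr>"

text \<open>Only the carrier is cut down, the operations remain those of \<open>V\<close>; hence all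
  inclusions are isometric.\<close>

lemma level_space_inclusion: "isometric_inclusion (level_space a) V"
  using isometric_inclusion_mono_carrier[of "cl ` level a" "carrier V" V] cl_level_carrier by auto

lemma complex_ip_space_level: "complex_ip_space (level_space a)"
  by (rule complex_ip_space_subspace[OF complex_ip_space_V level_space_inclusion])
    (auto simp: zero_V cl_level_ops(1) cl_level_ops(2) pw_zero_level pw_add_level pw_smult_level)

lemma hilbert_space_level: "hilbert_space (level_space a)"
proof -
  interpret L: complex_ip_space "level_space a" by (rule complex_ip_space_level)
  interpret Metric_space "carrier (level_space a)" "ip_dist (level_space a)"
    by (rule L.Metric_space_ip_dist)
  have dist: "ip_dist (level_space a) x y = ip_dist V x y" if "x \<in> cl ` level a" "y \<in> cl ` level a" for x y
    using that complex_ip_space_level complex_ip_space_V level_space_inclusion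
    by (intro isometric_inclusion_ip_dist) auto
  have mcomplete
  proof (rule mcompleteI_fast)
    \<comment> \<open>The root makes the squared increments at most \<open>(1/8) ^ n\<close>, the
      rate expected by \<open>level_geometric_limit\<close>.\<close>
    show "0 < sqrt ((1/8) ^ n)" for n :: nat by simp
    fix \<sigma> assume \<sigma>: "range \<sigma> \<subseteq> carrier (level_space a)"
      and fast: "\<And>n. ip_dist (level_space a) (\<sigma> n) (\<sigma> (Suc n)) < sqrt ((1/8) ^ n)"
    have "\<sigma> k \<in> cl ` level a" for k using subsetD[OF \<sigma> rangeI] by simp
    then have "\<forall>k. \<exists>v. v \<in> level a \<and> \<sigma> k = cl v" by blast
    then obtain u where "\<forall>k. u k \<in> level a \<and> \<sigma> k = cl (u k)" by (rule choice[THEN exE])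
    then have u: "\<And>k. u k \<in> level a" and \<sigma>u: "\<And>k. \<sigma> k = cl (u k)" by blast+
    have "(ip_dist V (cl (u k)) (cl (u (Suc k))))\<^sup>2 \<le> (1/8) ^ k" for k
    proof -
      have d: "ip_dist (level_space a) (\<sigma> k) (\<sigma> (Suc k)) = ip_dist V (cl (u k)) (cl (u (Suc k)))"
        using u by (simp add: dist \<sigma>u)
      have "(ip_dist V (cl (u k)) (cl (u (Suc k))))\<^sup>2 \<le> (sqrt ((1/8) ^ k))\<^sup>2"
        using fast[of k] nonneg unfolding d[symmetric] by (intro power_mono) auto
      then show ?thesis by simp
    qed
    then obtain l B where l: "l \<in> level a"
      and B: "\<And>k. (ip_dist V (cl (u k)) (cl l))\<^sup>2 \<le> B * (1/4) ^ k"
      using level_geometric_limit[of u a] u by blast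
    have "limitin mtopology \<sigma> (cl l) sequentially"
      unfolding limit_metric_sequentially
    proof (intro conjI allI impI)
      show "cl l \<in> carrier (level_space a)" using l by simp
      fix \<epsilon> :: real assume \<epsilon>: "0 < \<epsilon>"
      have "(\<lambda>k. B * (1/4) ^ k) \<longlonglongrightarrow> B * 0" by (intro tendsto_intros) auto
      then have "\<forall>\<^sub>F k in sequentially. B * (1/4) ^ k < \<epsilon>\<^sup>2"
        using \<epsilon> by (intro order_tendstoD(2)) auto
      then obtain N where N: "\<And>k. N \<le> k \<Longrightarrow> B * (1/4) ^ k < \<epsilon>\<^sup>2"
        by (auto simp: eventually_sequentially)
      show "\<exists>N. \<forall>n\<ge>N. \<sigma> n \<in> carrier (level_space a) \<and> ip_dist (level_space a) (\<sigma> n) (cl l) < \<epsilon>"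
      proof (intro exI allI impI conjI)
        fix n assume n: "N \<le> n"
        show "\<sigma> n \<in> carrier (level_space a)" using subsetD[OF \<sigma> rangeI] .
        have "(ip_dist (level_space a) (\<sigma> n) (cl l))\<^sup>2 < \<epsilon>\<^sup>2"
          using B[of n] N[OF n] u l by (simp add: dist \<sigma>u)
        then show "ip_dist (level_space a) (\<sigma> n) (cl l) < \<epsilon>"
          by (rule power2_less_imp_less) (use \<epsilon> in simp)
      qed
    qed
    then show "\<exists>x. limitin mtopology \<sigma> x sequentially" ..
  qed
  then show ?thesis by (intro hilbert_space.intro complex_ip_space_level hilbert_space_axioms.intro)
qed

lemma locally_hilbert_space_V: "locally_hilbert_space TYPE('i) V"
proof -
  have "strictly_inductive_system level_space"
    unfolding strictly_inductive_system_def
    using hilbert_space_level isometric_inclusion_mono_carrier[OF image_mono[OF level_mono]] by blast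
  moreover have "inductive_limit level_space V"
    by (simp add: inductive_limit_def carrier_V level_space_inclusion)
  ultimately show ?thesis unfolding locally_hilbert_space_def by blast
qed

end

theorem proposition3p11:
  fixes T :: "'i::directed_order \<Rightarrow> 'x topology"
    and M :: "'i \<Rightarrow> 'x measure"
    and H :: "'x \<Rightarrow> 'h ip_space"
    and E :: "'x \<Rightarrow> 'i \<Rightarrow> 'h ip_space"
    and D :: "'x \<Rightarrow> 'h ip_space"
    and \<D> :: "('x \<Rightarrow> 'h) set"
  assumes "locally_measure_system T M"
    and "\<And>p. p \<in> loc_space M \<Longrightarrow> quantized_domain (H p) (E p) (D p)"
    and "direct_integral M E D \<D>"
  shows "locally_hilbert_space TYPE('i) (direct_integral_space M D \<D>)"
proof -
  interpret direct_integral_family T M H E D \<D>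
    using assms by (intro direct_integral_family.intro direct_integral_family_axioms.intro)
  show ?thesis by (rule locally_hilbert_space_V)
qed

end
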